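(* Let $[\prod_{k=1}^K (N_k,M_k)]$ be a tightly-feasible $K$-user MIMO interference channel, and suppose there exist $\mathcal S_{\mathrm{RX}},\mathcal S_{\mathrm{TX}}\subseteq\mathcal K$ with $$\mathcal N_{\mathrm{Var}}(\mathcal S_{\mathrm{RX}},\mathcal S_{\mathrm{TX}})=\mathcal N_{\mathrm{Eq}}(\mathcal S_{\mathrm{RX}},\mathcal S_{\mathrm{TX}}).$$ Then the CSIT allocation $\mathcal A=\{\mathbf A^{(j)}: j\in\mathcal K\}$ given by $\mathbf A^{(j)}=\mathbf A_{\mathcal S_{\mathrm{RX}},\mathcal S_{\mathrm{TX}}}$ for $j\in\mathcal S_{\mathrm{TX}}$ and $\mathbf A^{(j)}=\mathbf 1_{N_{\mathrm{Tot}}\times M_{\mathrm{Tot}}}$ (the all-ones matrix) for $j\notin\mathcal S_{\mathrm{TX}}$ preserves IA feasibility, i.e. IA is feasible under $\mathcal A$.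
   Context: Setting: $K\ge2$ pairs; TX $j$ has $M_j\ge1$ antennas, RX $i$ has $N_i\ge1$ antennas, TX $j$ sends one stream to RX $j$; $\mathbf H_{ij}\in\mathbb C^{N_i\times M_j}$ is the channel from TX $j$ to RX $i$, all entries i.i.d. from a continuous distribution. $\mathcal K=\{1,\dots,K\}$, $N_{\mathrm{Tot}}=\sum_k N_k$, $M_{\mathrm{Tot}}=\sum_k M_k$, and $\mathbf H\in\mathbb C^{N_{\mathrm{Tot}}\times M_{\mathrm{Tot}}}$ is the block matrix with $(i,j)$ block $\mathbf H_{ij}$. Define $\mathcal N_{\mathrm{Var}}(\mathcal S_{\mathrm{RX}},\mathcal S_{\mathrm{TX}})=\sum_{i\in\mathcal S_{\mathrm{RX}}}(N_i-1)+\sum_{i\in\mathcal S_{\mathrm{TX}}}(M_i-1)$ and $\mathcal N_{\mathrm{Eq}}(\mathcal S_{\mathrm{RX}},\mathcal S_{\mathrm{TX}})=\#\{(j,k): j\in\mathcal S_{\mathrm{RX}},k\in\mathcal S_{\mathrm{TX}},j\ne k\}$. Single-stream IA (with full CSIT) is feasible iff $\mathcal N_{\mathrm{Var}}\ge\mathcal N_{\mathrm{Eq}}$ for all pairs of subsets of $\mathcal K$. The channel is tightly-feasible if IA is feasible and $\sum_{i=1}^K(N_i+M_i)=K(K+1)$. CSIT model: a CSIT allocation is a family $\mathcal A=\{\mathbf A^{(j)}\}_{j\in\mathcal K}$ of matrices $\mathbf A^{(j)}\in\{0,1\}^{N_{\mathrm{Tot}}\times M_{\mathrm{Tot}}}$;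 TX $j$ knows exactly $\mathbf H^{(j)}=\mathbf A^{(j)}\odot\mathbf H$ (Hadamard product). IA is feasible under $\mathcal A$ if there exist maps assigning to each TX $j$ a beamformer $\mathbf t_j\in\mathbb C^{M_j}\setminus\{0\}$ that is a function of $\mathbf H^{(j)}$ only, such that with probability one there exist nonzero receive vectors $\mathbf g_i\in\mathbb C^{N_i}$ with $\mathbf g_i^H\mathbf H_{ij}\mathbf t_j=0$ for all $i\neq j$. For $\mathcal S_{\mathrm{RX}},\mathcal S_{\mathrm{TX}}\subseteq\mathcal K$, $\mathbf A_{\mathcal S_{\mathrm{RX}},\mathcal S_{\mathrm{TX}}}\in\{0,1\}^{N_{\mathrm{Tot}}\times M_{\mathrm{Tot}}}$ is the matrix whose $(x,y)$ block (of size $N_x\times M_y$, in the same block partition as $\mathbf H$) is all ones if $x\in\mathcal S_{\mathrm{RX}}$, $y\in\mathcal S_{\mathrm{TX}}$, $x\ne y$, and all zeros otherwise. *)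

theory Defs
  imports "HOL-Probability.Probability"
begin

text \<open>Users are indexed by \<open>{1..K}\<close>. A channel entry is addressed by
  \<open>(i, j, r, c)\<close>: block \<open>(i,j)\<close> (RX \<open>i\<close>, TX \<open>j\<close>), row \<open>r < N i\<close>, column \<open>c < M j\<close>.\<close>

type_synonym idx = "nat \<times> nat \<times> nat \<times> nat"

definition users :: "nat \<Rightarrow> nat set" where
  "users K = {1..K}"

definition chan_idx :: "nat \<Rightarrow> (nat \<Rightarrow> nat) \<Rightarrow> (nat \<Rightarrow> nat) \<Rightarrow> idx set" where
  "chan_idx K N M = {(i, j, r, c). i \<in> users K \<and> j \<in> users K \<and> r < N i \<and> c < M j}"

definition N_Var :: "(nat \<Rightarrow> nat) \<Rightarrow> (nat \<Rightarrow> nat) \<Rightarrow> nat set \<Rightarrow> nat set \<Rightarrow> int" where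
  "N_Var N M SR ST = (\<Sum>i\<in>SR. int (N i) - 1) + (\<Sum>i\<in>ST. int (M i) - 1)"

definition N_Eq :: "nat set \<Rightarrow> nat set \<Rightarrow> int" where
  "N_Eq SR ST = int (card {(j, k). j \<in> SR \<and> k \<in> ST \<and> j \<noteq> k})"

text \<open>Single-stream IA feasibility with full CSIT (characterization given in the setting).\<close>
definition IA_feasible_full :: "nat \<Rightarrow> (nat \<Rightarrow> nat) \<Rightarrow> (nat \<Rightarrow> nat) \<Rightarrow> bool" where
  "IA_feasible_full K N M =
     (\<forall>SR ST. SR \<subseteq> users K \<longrightarrow> ST \<subseteq> users K \<longrightarrow> N_Var N M SR ST \<ge> N_Eq SR ST)"

definition tightly_feasible :: "nat \<Rightarrow> (nat \<Rightarrow> nat) \<Rightarrow> (nat \<Rightarrow> nat) \<Rightarrow> bool" where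
  "tightly_feasible K N M =
     (IA_feasible_full K N M \<and> (\<Sum>i=1..K. N i + M i) = K * (K + 1))"

text \<open>A 0/1 matrix in the block partition of \<open>H\<close> is encoded as a predicate on
  entry positions (True = 1, False = 0). A CSIT allocation assigns one such matrix to each TX.\<close>

definition A_blocks :: "nat set \<Rightarrow> nat set \<Rightarrow> idx \<Rightarrow> bool" where
  "A_blocks SR ST = (\<lambda>(x, y, r, c). x \<in> SR \<and> y \<in> ST \<and> x \<noteq> y)"

definition all_ones :: "idx \<Rightarrow> bool" where
  "all_ones = (\<lambda>_. True)"

definition hadamard :: "nat \<Rightarrow> (nat \<Rightarrow> nat) \<Rightarrow> (nat \<Rightarrow> nat) \<Rightarrow> (idx \<Rightarrow> bool) \<Rightarrow> (idx \<Rightarrow> complex) \<Rightarrow> idx \<Rightarrow> complex" where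
  "hadamard K N M A H = (\<lambda>x. if x \<in> chan_idx K N M \<and> A x then H x else 0)"

definition continuous_distr :: "complex measure \<Rightarrow> bool" where
  "continuous_distr \<mu> = (prob_space \<mu> \<and> sets \<mu> = sets lborel \<and> absolutely_continuous lborel \<mu>)"

text \<open>IA feasibility under CSIT allocation \<open>A\<close>, when the channel entries are i.i.d. with law \<open>\<mu>\<close>:
  there are maps \<open>f j\<close> giving TX \<open>j\<close> a nonzero beamformer in \<open>\<complex>^(M j)\<close> as a function of
  \<open>A j \<odot> H\<close> only, such that almost surely there exist nonzero receive vectors \<open>g i \<in> \<complex>^(N i)\<close>
  with \<open>g i^H H_ij t_j = 0\<close> for all \<open>i \<noteq> j\<close>.\<close>
definition IA_feasible_under ::
  "nat \<Rightarrow> (nat \<Rightarrow> nat) \<Rightarrow> (nat \<Rightarrow> nat) \<Rightarrow> complex measure \<Rightarrow> (nat \<Rightarrow> idx \<Rightarrow> bool) \<Rightarrow> bool" where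
  "IA_feasible_under K N M \<mu> A =
    (\<exists>f :: nat \<Rightarrow> (idx \<Rightarrow> complex) \<Rightarrow> (nat \<Rightarrow> complex).
       (\<forall>j\<in>users K. \<forall>G. \<exists>c<M j. f j G c \<noteq> 0) \<and>
       (AE H in PiM (chan_idx K N M) (\<lambda>_. \<mu>).
          \<exists>g :: nat \<Rightarrow> nat \<Rightarrow> complex.
            (\<forall>i\<in>users K. \<exists>r<N i. g i r \<noteq> 0) \<and>
            (\<forall>i\<in>users K. \<forall>j\<in>users K. i \<noteq> j \<longrightarrow>
               (\<Sum>r<N i. \<Sum>c<M j. cnj (g i r) * H (i, j, r, c) * f j (hadamard K N M (A j) H) c) = 0)))"

end

theory Submission
  imports Defs "HOL-Library.Multiset" "HOL-Computational_Algebra.Fundamental_Theorem_Algebra"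
begin

text \<open>
  The counting condition makes the alignment equations solvable for \<^emph>\<open>every\<close> channel matrix, so no
  probability is involved. TX \<open>j \<in> ST\<close> picks its beamformer from a solution of the
  subsystem on \<open>SR \<times> ST\<close>, which depends on the known blocks only. Fixing these vectors amounts to
  replacing the users involved by single-antenna ones, and because the subsystem is tight, the
  remaining system satisfies the counting condition again.

  Solvability of a bilinear system \<open>b\<^sub>e(x) = 0\<close> whose edges \<open>e\<close> satisfy the counting condition: by a
  Hall-type argument every edge is assigned to one of its endpoints such that vertex \<open>v\<close> receives at
  most \<open>N v - 1\<close> edges; give the edges of \<open>v\<close> distinct nonzero coordinates \<open>k\<^sub>e\<close>. The perturbed system
  \<open>b\<^sub>e(x) + \<tau> x\<^sub>v\<^sub>,\<^sub>k x\<^sub>w\<^sub>,\<^sub>0 = 0\<close> becomes a contraction for large \<open>\<tau>\<close> in the chart \<open>x\<^sub>v\<^sub>,\<^sub>0 = 1\<close>, so it has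
  solutions for infinitely many \<open>\<tau>\<close>. If the original system had no solution, then by the
  Nullstellensatz every monomial of a large multidegree would lie in the ideal of the \<open>b\<^sub>e\<close>. At a
  solution of the perturbed system, the vector of these monomials would be an eigenvector, with
  eigenvalue \<open>-1/\<tau>\<close>, of a matrix that does not depend on \<open>\<tau>\<close>, which allows only finitely many \<open>\<tau>\<close>.
\<close>

section \<open>Linear relations, orientations and contractions\<close>

text \<open>Gaussian elimination, one equation at a time. Equation \<open>b\<close> is solved for
  the coefficient at a pivot \<open>a0\<close>, and \<open>m'\<close> is the matrix left after
  substitution; if \<open>b\<close> has no pivot on \<open>A\<close>, it holds
  automatically.\<close>

lemma underdetermined_system:
  fixes m :: "'a \<Rightarrow> 'b \<Rightarrow> 'c :: field"
  assumes "finite B" "finite A" "card B < card A"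
  shows "\<exists>c. (\<exists>a\<in>A. c a \<noteq> 0) \<and> (\<forall>b\<in>B. (\<Sum>a\<in>A. c a * m a b) = 0)"
  using assms
proof (induction B arbitrary: A m rule: finite_induct)
  case empty
  then obtain a where "a \<in> A" by fastforce
  then show ?case by (intro exI[of _ "\<lambda>_. 1"]) auto
next
  case (insert b B)
  show ?case
  proof (cases "\<exists>a0\<in>A. m a0 b \<noteq> 0")
    case False
    have "card B < card A" using insert by simp
    from insert.IH[OF insert.prems(1) this, of m] obtain c where
      c: "\<exists>a\<in>A. c a \<noteq> 0" "\<forall>b\<in>B. (\<Sum>a\<in>A. c a * m a b) = 0" by blast
    have "(\<Sum>a\<in>A. c a * m a b) = 0" using False by (intro sum.neutral) auto
    with c show ?thesis by blast
  next
    case True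
    then obtain a0 where a0: "a0 \<in> A" "m a0 b \<noteq> 0" by blast
    let ?A = "A - {a0}"
    define m' where "m' a d = m a d - m a b / m a0 b * m a0 d" for a d
    have "card B < card ?A" using insert a0 by simp
    from insert.IH[OF _ this, of m'] obtain c where
      c: "\<exists>a\<in>?A. c a \<noteq> 0" "\<forall>d\<in>B. (\<Sum>a\<in>?A. c a * m' a d) = 0"
      using insert.prems by blast
    define c' where "c' a = (if a = a0 then - (\<Sum>a\<in>?A. c a * m a b) / m a0 b else c a)" for a
    have split: "(\<Sum>a\<in>A. c' a * m a d) = (\<Sum>a\<in>?A. c a * m' a d)" for d
    proof -
      have "(\<Sum>a\<in>A. c' a * m a d) = c' a0 * m a0 d + (\<Sum>a\<in>?A. c' a * m a d)"
        using a0 insert.prems by (simp add: sum.remove)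
      also have "(\<Sum>a\<in>?A. c' a * m a d) = (\<Sum>a\<in>?A. c a * m a d)"
        by (intro sum.cong) (auto simp: c'_def)
      also have "c' a0 * m a0 d = - (\<Sum>a\<in>?A. c a * (m a b / m a0 b * m a0 d))"
        by (simp add: c'_def sum_distrib_right sum_divide_distrib mult.assoc)
      finally show ?thesis by (simp add: m'_def right_diff_distrib sum_subtractf)
    qed
    have "(\<Sum>a\<in>?A. c a * m' a b) = 0" using a0 by (intro sum.neutral) (auto simp: m'_def)
    then have "\<forall>d\<in>insert b B. (\<Sum>a\<in>A. c' a * m a d) = 0" using c(2) split by auto
    moreover have "\<exists>a\<in>A. c' a \<noteq> 0" using c(1) by (auto simp: c'_def)
    ultimately show ?thesis by blast
  qed
qed

text \<open>Hall's theorem for edges that choose an endpoint. A new edge goes to an endpoint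
  \<open>u\<close>, whose capacity drops by one, unless some set containing \<open>u\<close> is
  already full. Suppose full sets \<open>W1\<close> and \<open>W2\<close> block both endpoints. The
  number of edges inside a vertex set is supermodular and the capacity is modular, so
  \<open>W1 \<union> W2\<close> is full as well and has no room for the new edge.\<close>

lemma bounded_orientation_exists:
  fixes cap :: "'v \<Rightarrow> nat" and E :: "('v \<times> 'v) set"
  assumes "finite E" "finite V" "E \<subseteq> V \<times> V"
    and "\<And>W. W \<subseteq> V \<Longrightarrow> card (E \<inter> W \<times> W) \<le> sum cap W"
  shows "\<exists>own. (\<forall>e\<in>E. own e = fst e \<or> own e = snd e) \<and> (\<forall>v\<in>V. card {e \<in> E. own e = v} \<le> cap v)"
  using assms(1,3,4)
proof (induction E arbitrary: cap rule: finite_induct)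
  case empty
  then show ?case by simp
next
  case (insert e E)
  obtain v w where e: "e = (v, w)" by fastforce
  have vw: "v \<in> V" "w \<in> V" using insert.prems(1) e by auto
  have finW: "finite W" if "W \<subseteq> V" for W using that assms(2) finite_subset by blast
  have cardE: "card (insert e E \<inter> W \<times> W) =
      card (E \<inter> W \<times> W) + (if v \<in> W \<and> w \<in> W then 1 else 0)" for W
    using insert.hyps e by auto
  \<comment> \<open>Giving \<open>e\<close> to \<open>u\<close> costs every set containing
    \<open>u\<close> one unit of capacity; the strict inequality in the assumption pays for
    it.\<close>
  have assign: ?case if u: "u = v \<or> u = w" "cap u > 0"
    "\<And>W. W \<subseteq> V \<Longrightarrow> u \<in> W \<Longrightarrow> card (E \<inter> W \<times> W) < sum cap W" for u
  proof -
    define cap' where "cap' = cap(u := cap u - 1)"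
    have uV: "u \<in> V" using u vw by auto
    have sumcap: "sum cap W = sum cap' W + (if u \<in> W then 1 else 0)" if "W \<subseteq> V" for W
    proof (cases "u \<in> W")
      case True
      have "sum cap W = cap u + sum cap (W - {u})" "sum cap' W = cap' u + sum cap' (W - {u})"
        using True finW[OF that] by (simp_all add: sum.remove)
      moreover have "sum cap' (W - {u}) = sum cap (W - {u})"
        by (intro sum.cong) (auto simp: cap'_def)
      ultimately show ?thesis using u(2) True by (simp add: cap'_def)
    next
      case False
      then have "sum cap' W = sum cap W" by (intro sum.cong) (auto simp: cap'_def)
      then show ?thesis using False by simp
    qed
    have "card (E \<inter> W \<times> W) \<le> sum cap' W" if "W \<subseteq> V" for W
      using sumcap[OF that] u(3)[OF that] insert.prems(2)[OF that] cardE[of W]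
      by (cases "u \<in> W") auto
    with insert.IH[of cap'] insert.prems(1) obtain own where
      own: "\<forall>e\<in>E. own e = fst e \<or> own e = snd e" "\<forall>v\<in>V. card {e \<in> E. own e = v} \<le> cap' v"
      by blast
    define own' where "own' = own(e := u)"
    have set_eq: "{e' \<in> insert e E. own' e' = z} = {e' \<in> E. own e' = z} \<union> (if z = u then {e} else {})" for z
      using insert.hyps by (auto simp: own'_def)
    have "card {e' \<in> insert e E. own' e' = z} \<le> cap z" if "z \<in> V" for z
      using own(2)[rule_format, OF that] u(2) insert.hyps unfolding set_eq
      by (auto simp: cap'_def)
    then show ?thesis
      using own(1) u(1) e by (intro exI[of _ own']) (auto simp: own'_def)
  qed
  have tight: "\<exists>W\<subseteq>V. u \<in> W \<and> card (E \<inter> W \<times> W) \<ge> sum cap W"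
    if "u = v \<or> u = w" "\<not> ?case" for u
  proof (cases "cap u = 0")
    case True
    then show ?thesis using that vw by (intro exI[of _ "{u}"]) auto
  next
    case False
    then show ?thesis using assign[OF that(1)] that(2) not_less by blast
  qed
  show ?case
  proof (rule ccontr)
    assume neg: "\<not> ?case"
    obtain W1 where W1: "W1 \<subseteq> V" "v \<in> W1" "card (E \<inter> W1 \<times> W1) \<ge> sum cap W1"
      using tight[OF _ neg] by blast
    obtain W2 where W2: "W2 \<subseteq> V" "w \<in> W2" "card (E \<inter> W2 \<times> W2) \<ge> sum cap W2"
      using tight[OF _ neg] by blast
    have fin: "finite (E \<inter> X)" for X using insert.hyps by blast
    have "sum cap (W1 \<union> W2) + sum cap (W1 \<inter> W2) = sum cap W1 + sum cap W2"
      using sum.union_inter[of W1 W2 cap] finW W1 W2 by simp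
    moreover have "card (E \<inter> W1 \<times> W1) + card (E \<inter> W2 \<times> W2) =
        card (E \<inter> W1 \<times> W1 \<union> E \<inter> W2 \<times> W2) + card (E \<inter> (W1 \<inter> W2) \<times> (W1 \<inter> W2))"
    proof -
      have "E \<inter> W1 \<times> W1 \<inter> (E \<inter> W2 \<times> W2) = E \<inter> (W1 \<inter> W2) \<times> (W1 \<inter> W2)" by auto
      then show ?thesis using card_Un_Int[OF fin fin, of "W1 \<times> W1" "W2 \<times> W2"] by simp
    qed
    moreover have "card (E \<inter> W1 \<times> W1 \<union> E \<inter> W2 \<times> W2) \<le> card (E \<inter> (W1 \<union> W2) \<times> (W1 \<union> W2))"
      by (intro card_mono fin) auto
    moreover have "card (E \<inter> (W1 \<union> W2) \<times> (W1 \<union> W2)) + 1 \<le> sum cap (W1 \<union> W2)"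
      using insert.prems(2)[of "W1 \<union> W2"] W1 W2 cardE[of "W1 \<union> W2"] by auto
    moreover have "card (E \<inter> (W1 \<inter> W2) \<times> (W1 \<inter> W2)) \<le> sum cap (W1 \<inter> W2)"
    proof -
      have "W1 \<inter> W2 \<subseteq> V" using W1(1) by blast
      then show ?thesis using insert.prems(2)[of "W1 \<inter> W2"] cardE[of "W1 \<inter> W2"] by linarith
    qed
    ultimately show False using W1(3) W2(3) by linarith
  qed
qed

text \<open>Banach's fixed point theorem on the closed unit polydisc in the coordinates
  \<open>E\<close>. The iterates of 0 converge in each coordinate, with a geometric rate uniform
  over \<open>E\<close>.\<close>

lemma contraction_fixpoint:
  fixes F :: "('e \<Rightarrow> complex) \<Rightarrow> 'e \<Rightarrow> complex"
  assumes maps: "\<And>X e. (\<forall>e\<in>E. norm (X e) \<le> 1) \<Longrightarrow> e \<in> E \<Longrightarrow> norm (F X e) \<le> 1"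
    and contr: "\<And>X Y \<delta> e. (\<forall>e\<in>E. norm (X e) \<le> 1) \<Longrightarrow> (\<forall>e\<in>E. norm (Y e) \<le> 1) \<Longrightarrow>
        (\<forall>e\<in>E. norm (X e - Y e) \<le> \<delta>) \<Longrightarrow> e \<in> E \<Longrightarrow> norm (F X e - F Y e) \<le> \<delta> / 2"
  shows "\<exists>X. \<forall>e\<in>E. F X e = X e"
proof -
  define X where "X n = (F ^^ n) (\<lambda>_. 0)" for n
  have X_Suc: "X (Suc n) = F (X n)" for n by (simp add: X_def)
  have bd: "\<forall>e\<in>E. norm (X n e) \<le> 1" for n
  proof (induction n)
    case 0
    show ?case by (simp add: X_def)
  next
    case (Suc n)
    then show ?case using maps by (simp add: X_Suc)
  qed
  \<comment> \<open>Coordinates of two points of the polydisc differ by at most 2, and each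
    application of \<open>F\<close> halves the bound.\<close>
  have shift: "\<forall>e\<in>E. norm (X (n + k) e - X n e) \<le> 2 * (1/2) ^ n" for n k
  proof (induction n)
    case 0
    have "norm (X k e - X 0 e) \<le> 2" if "e \<in> E" for e
      using bd[of k] bd[of 0] that norm_triangle_ineq4[of "X k e" "X 0 e"] by fastforce
    then show ?case by simp
  next
    case (Suc n)
    then show ?case using contr[OF bd bd Suc] by (simp add: X_Suc)
  qed
  have "\<exists>L. (\<lambda>n. X n e) \<longlonglongrightarrow> L" if "e \<in> E" for e
  proof -
    have "Cauchy (\<lambda>n. X n e)"
    proof (rule CauchyI')
      fix \<epsilon> :: real assume "\<epsilon> > 0"
      then obtain M where "(1/2::real) ^ M < \<epsilon> / 2" using real_arch_pow_inv[of "\<epsilon>/2" "1/2"] by auto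
      show "\<exists>M. \<forall>m\<ge>M. \<forall>n>m. dist (X m e) (X n e) < \<epsilon>"
      proof (intro exI[of _ M] allI impI)
        fix m n assume "M \<le> m" "m < n"
        then have "norm (X n e - X m e) \<le> 2 * (1/2) ^ m"
          using shift[of m "n - m"] that by auto
        also have "\<dots> \<le> 2 * (1/2) ^ M" using \<open>M \<le> m\<close> by (simp add: power_decreasing)
        also have "\<dots> < \<epsilon>" using \<open>(1/2::real) ^ M < \<epsilon> / 2\<close> by simp
        finally show "dist (X m e) (X n e) < \<epsilon>" by (simp add: dist_norm norm_minus_commute)
      qed
    qed
    then show ?thesis by (simp add: Cauchy_convergent_iff convergent_def)
  qed
  then obtain L where L: "\<And>e. e \<in> E \<Longrightarrow> (\<lambda>n. X n e) \<longlonglongrightarrow> L e" by metis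
  have L1: "\<forall>e\<in>E. norm (L e) \<le> 1"
    using bd by (auto intro!: LIMSEQ_le_const2[OF tendsto_norm[OF L]])
  have dist: "\<forall>e\<in>E. norm (L e - X n e) \<le> 2 * (1/2) ^ n" for n
  proof
    fix e assume e: "e \<in> E"
    have "(\<lambda>k. norm (X (n + k) e - X n e)) \<longlonglongrightarrow> norm (L e - X n e)"
      using LIMSEQ_ignore_initial_segment[OF L[OF e], of n]
      by (intro tendsto_intros) (simp add: add.commute)
    then show "norm (L e - X n e) \<le> 2 * (1/2) ^ n"
      using shift e by (auto intro!: LIMSEQ_le_const2)
  qed
  have "F L e = L e" if e: "e \<in> E" for e
  proof -
    have "norm (F L e - X (Suc n) e) \<le> (1/2) ^ n" for n
      using contr[OF L1 bd dist e, of n] by (simp add: X_Suc)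
    then have "(\<lambda>n. F L e - X (Suc n) e) \<longlonglongrightarrow> 0"
      by (intro Lim_null_comparison[OF _ LIMSEQ_power_zero[of "1/2::real"]]) auto
    moreover have "(\<lambda>n. F L e - X (Suc n) e) \<longlonglongrightarrow> F L e - L e"
      using LIMSEQ_Suc[OF L[OF e]] by (intro tendsto_intros)
    ultimately show ?thesis using LIMSEQ_unique by fastforce
  qed
  then show ?thesis by blast
qed

section \<open>Polynomial functions and the weak Nullstellensatz\<close>

text \<open>Monomials are indexed by multisets of variables, so degree is size and product is sum.
  Polynomials are functions, and identities are checked pointwise.\<close>

definition mono_fun :: "'x multiset \<Rightarrow> ('x \<Rightarrow> complex) \<Rightarrow> complex" where
  "mono_fun A x = prod_mset (image_mset x A)"

lemma mono_fun_simps [simp]: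
  "mono_fun {#} x = 1"
  "mono_fun (add_mset a A) x = x a * mono_fun A x"
  "mono_fun (A + B) x = mono_fun A x * mono_fun B x"
  by (simp_all add: mono_fun_def)

inductive_set mono_span :: "'x multiset set \<Rightarrow> (('x \<Rightarrow> complex) \<Rightarrow> complex) set"
  for B :: "'x multiset set" where
  zero: "(\<lambda>x. 0) \<in> mono_span B"
| step: "f \<in> mono_span B \<Longrightarrow> A \<in> B \<Longrightarrow> (\<lambda>x. f x + c * mono_fun A x) \<in> mono_span B"

lemma mono_span_mono: "f \<in> mono_span B \<Longrightarrow> B \<subseteq> B' \<Longrightarrow> f \<in> mono_span B'"
  by (induction rule: mono_span.induct) (auto intro: mono_span.intros)

lemma mono_span_base: "A \<in> B \<Longrightarrow> mono_fun A \<in> mono_span B"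
  using mono_span.step[OF mono_span.zero, of A B 1] by simp

lemma mono_span_add: "g \<in> mono_span B \<Longrightarrow> f \<in> mono_span B \<Longrightarrow> (\<lambda>x. f x + g x) \<in> mono_span B"
proof (induction rule: mono_span.induct)
  case (step g A c)
  then show ?case using mono_span.step[of "\<lambda>x. f x + g x" B A c] by (simp add: add.assoc)
qed simp

lemma mono_span_sum:
  "finite S \<Longrightarrow> (\<And>s. s \<in> S \<Longrightarrow> f s \<in> mono_span B) \<Longrightarrow> (\<lambda>x. \<Sum>s\<in>S. f s x) \<in> mono_span B"
  by (induction S rule: finite_induct) (auto intro: mono_span.zero mono_span_add)

lemma mono_span_times_mono:
  assumes "f \<in> mono_span B" "\<And>A. A \<in> B \<Longrightarrow> A + C \<in> B'"
  shows "(\<lambda>x. f x * (c * mono_fun C x)) \<in> mono_span B'"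
  using assms
proof (induction rule: mono_span.induct)
  case zero
  then show ?case by (simp add: mono_span.zero)
next
  case (step f A d)
  then show ?case using mono_span.step[of "\<lambda>x. f x * (c * mono_fun C x)" B' "A + C" "d * c"]
    by (simp add: algebra_simps)
qed

lemma mono_span_mult:
  assumes "g \<in> mono_span C" "f \<in> mono_span B" "\<And>a c. a \<in> B \<Longrightarrow> c \<in> C \<Longrightarrow> a + c \<in> B'"
  shows "(\<lambda>x. f x * g x) \<in> mono_span B'"
  using assms
proof (induction rule: mono_span.induct)
  case zero
  then show ?case by (simp add: mono_span.zero)
next
  case (step g A c)
  have "(\<lambda>x. f x * (c * mono_fun A x)) \<in> mono_span B'"
    using step by (intro mono_span_times_mono[of _ B]) auto
  with step have "(\<lambda>x. f x * g x + f x * (c * mono_fun A x)) \<in> mono_span B'"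
    by (intro mono_span_add) auto
  then show ?case by (simp add: algebra_simps)
qed

lemma mono_span_coeffs:
  assumes "f \<in> mono_span B" "finite B"
  shows "\<exists>c. \<forall>x. f x = (\<Sum>A\<in>B. c A * mono_fun A x)"
  using assms
proof (induction rule: mono_span.induct)
  case zero
  show ?case by (intro exI[of _ "\<lambda>_. 0"]) simp
next
  case (step f A d)
  then obtain c where c: "\<forall>x. f x = (\<Sum>A\<in>B. c A * mono_fun A x)" by blast
  have "f x + d * mono_fun A x = (\<Sum>A'\<in>B. (c A' + (if A' = A then d else 0)) * mono_fun A' x)" for x
  proof -
    have "(\<Sum>A'\<in>B. (if A' = A then d else 0) * mono_fun A' x) =
        (\<Sum>A'\<in>B. if A' = A then d * mono_fun A' x else 0)"
      by (intro sum.cong) auto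
    also have "\<dots> = d * mono_fun A x" using step by simp
    finally show ?thesis by (simp add: c distrib_right sum.distrib)
  qed
  then show ?case by (intro exI[of _ "\<lambda>A'. c A' + (if A' = A then d else 0)"]) blast
qed

definition polyf :: "'x set \<Rightarrow> (('x \<Rightarrow> complex) \<Rightarrow> complex) set" where
  "polyf X = mono_span {A. set_mset A \<subseteq> X}"

lemma mono_fun_in_polyf: "set_mset A \<subseteq> X \<Longrightarrow> mono_fun A \<in> polyf X"
  unfolding polyf_def by (rule mono_span_base) simp

lemma polyf_const: "(\<lambda>x. c) \<in> polyf X"
  using mono_span.step[OF mono_span.zero, of "{#}" "{A. set_mset A \<subseteq> X}" c] by (simp add: polyf_def)

lemma polyf_var: "a \<in> X \<Longrightarrow> (\<lambda>x. x a) \<in> polyf X"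
  using mono_fun_in_polyf[of "{#a#}" X] by (simp add: mono_fun_def[abs_def])

lemma polyf_add: "f \<in> polyf X \<Longrightarrow> g \<in> polyf X \<Longrightarrow> (\<lambda>x. f x + g x) \<in> polyf X"
  unfolding polyf_def by (rule mono_span_add)

lemma polyf_mult: "f \<in> polyf X \<Longrightarrow> g \<in> polyf X \<Longrightarrow> (\<lambda>x. f x * g x) \<in> polyf X"
  unfolding polyf_def by (rule mono_span_mult) auto

lemma polyf_diff: "f \<in> polyf X \<Longrightarrow> g \<in> polyf X \<Longrightarrow> (\<lambda>x. f x - g x) \<in> polyf X"
  using polyf_add[OF _ polyf_mult[OF polyf_const[of "-1"]], of f X g] by simp

lemma polyf_poly: "f \<in> polyf X \<Longrightarrow> (\<lambda>x. poly q (f x)) \<in> polyf X"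
  by (induction q) (auto intro: polyf_const polyf_add polyf_mult)

lemma finite_msets_bounded_size:
  assumes "finite X"
  shows "finite {A. set_mset A \<subseteq> X \<and> size A \<le> n}"
proof -
  have "{A. set_mset A \<subseteq> X \<and> size A \<le> n} \<subseteq> mset ` {xs. set xs \<subseteq> X \<and> length xs \<le> n}"
  proof
    fix A assume A: "A \<in> {A. set_mset A \<subseteq> X \<and> size A \<le> n}"
    obtain xs where "mset xs = A" using ex_mset by blast
    with A show "A \<in> mset ` {xs. set xs \<subseteq> X \<and> length xs \<le> n}" by force
  qed
  then show ?thesis using finite_lists_length_le[OF assms] finite_surj by blast
qed

text \<open>Exhausts the polynomials in finitely many variables by countably many finite-dimensional
  spaces, which later permits a pigeonhole argument over uncountably many polynomials.\<close>

lemma polyf_bounded_degree: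
  assumes "f \<in> polyf X"
  shows "\<exists>n. f \<in> mono_span {A. set_mset A \<subseteq> X \<and> size A \<le> n}"
  using assms unfolding polyf_def
proof (induction rule: mono_span.induct)
  case zero
  show ?case by (auto intro: mono_span.zero)
next
  case (step f A c)
  then obtain n where "f \<in> mono_span {A. set_mset A \<subseteq> X \<and> size A \<le> n}" by blast
  then have "f \<in> mono_span {C. set_mset C \<subseteq> X \<and> size C \<le> max n (size A)}"
    by (rule mono_span_mono) auto
  then show ?case using step.hyps(2) by (intro exI[of _ "max n (size A)"] mono_span.step) auto
qed

section \<open>Ideals of polynomial functions\<close>

inductive_set poly_ideal ::
  "'x set \<Rightarrow> (('x \<Rightarrow> complex) \<Rightarrow> complex) set \<Rightarrow> (('x \<Rightarrow> complex) \<Rightarrow> complex) set"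
  for X :: "'x set" and G :: "(('x \<Rightarrow> complex) \<Rightarrow> complex) set" where
  zero: "(\<lambda>x. 0) \<in> poly_ideal X G"
| step: "f \<in> poly_ideal X G \<Longrightarrow> p \<in> polyf X \<Longrightarrow> g \<in> G \<Longrightarrow> (\<lambda>x. f x + p x * g x) \<in> poly_ideal X G"

lemma poly_ideal_base: "g \<in> G \<Longrightarrow> g \<in> poly_ideal X G"
  using poly_ideal.step[OF poly_ideal.zero polyf_const[of 1], of g G X] by simp

lemma poly_ideal_add:
  "g \<in> poly_ideal X G \<Longrightarrow> f \<in> poly_ideal X G \<Longrightarrow> (\<lambda>x. f x + g x) \<in> poly_ideal X G"
proof (induction rule: poly_ideal.induct)
  case (step g p h)
  then show ?case using poly_ideal.step[of "\<lambda>x. f x + g x" X G p h] by (simp add: add.assoc)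
qed simp

lemma poly_ideal_mult:
  "f \<in> poly_ideal X G \<Longrightarrow> p \<in> polyf X \<Longrightarrow> (\<lambda>x. p x * f x) \<in> poly_ideal X G"
proof (induction rule: poly_ideal.induct)
  case zero
  show ?case by (simp add: poly_ideal.zero)
next
  case (step f q g)
  then have "(\<lambda>x. p x * f x + (p x * q x) * g x) \<in> poly_ideal X G"
    by (intro poly_ideal.step polyf_mult) auto
  then show ?case by (simp add: algebra_simps)
qed

lemma poly_ideal_diff:
  "f \<in> poly_ideal X G \<Longrightarrow> g \<in> poly_ideal X G \<Longrightarrow> (\<lambda>x. f x - g x) \<in> poly_ideal X G"
  using poly_ideal_add[OF poly_ideal_mult[OF _ polyf_const[of "-1"]], of g X G f] by simp

lemma poly_ideal_sum:
  "finite S \<Longrightarrow> (\<And>s. s \<in> S \<Longrightarrow> f s \<in> poly_ideal X G) \<Longrightarrow> (\<lambda>x. \<Sum>s\<in>S. f s x) \<in> poly_ideal X G"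
  by (induction S rule: finite_induct) (auto intro: poly_ideal.zero poly_ideal_add)

text \<open>Collects all multiples of \<open>h\<close> into one coefficient \<open>p\<close>. For
  \<open>f = 1\<close> this makes \<open>p\<close> an inverse of \<open>h\<close> modulo the ideal
  of \<open>G\<close>.\<close>

lemma poly_ideal_insertD:
  assumes "f \<in> poly_ideal X (insert h G)"
  shows "\<exists>p\<in>polyf X. (\<lambda>x. f x - p x * h x) \<in> poly_ideal X G"
  using assms
proof (induction rule: poly_ideal.induct)
  case zero
  show ?case by (intro bexI[of _ "\<lambda>_. 0"]) (auto intro: poly_ideal.zero polyf_const)
next
  case (step f q g)
  then obtain p where p: "p \<in> polyf X" "(\<lambda>x. f x - p x * h x) \<in> poly_ideal X G" by blast
  show ?case
  proof (cases "g = h")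
    case True
    show ?thesis
      using p step by (intro bexI[of _ "\<lambda>x. p x + q x"] polyf_add) (auto simp: True algebra_simps)
  next
    case False
    then have "g \<in> G" using step by auto
    from poly_ideal.step[OF p(2) step(2) this] show ?thesis
      by (intro bexI[OF _ p(1)]) (simp add: algebra_simps)
  qed
qed

section \<open>The weak Nullstellensatz over the complex numbers\<close>

text \<open>Over \<complex> the polynomial \<open>q\<close> splits into linear factors. Each
  \<open>y - a\<close> is invertible modulo the ideal, so the factors cancel one by one until a
  nonzero constant remains.\<close>

lemma poly_ideal_univariate:
  assumes y: "y \<in> polyf X"
    and inv: "\<And>a. (\<lambda>x. 1) \<in> poly_ideal X (insert (\<lambda>x. y x - a) G)"
    and "(\<lambda>x. poly q (y x)) \<in> poly_ideal X G" "q \<noteq> 0"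
  shows "(\<lambda>x. 1) \<in> poly_ideal X G"
  using assms(3,4)
proof (induction "degree q" arbitrary: q)
  case 0
  then obtain c where "q = [:c:]" "c \<noteq> 0" by (metis degree_eq_zeroE pCons_0_0)
  then show ?case using poly_ideal_mult[OF "0.prems"(1) polyf_const[of "1/c"]] by simp
next
  case (Suc n)
  then have "\<not> constant (poly q)" by (simp add: constant_degree)
  then obtain a where "poly q a = 0" using fundamental_theorem_of_algebra by blast
  then obtain q' where q': "q = [:-a, 1:] * q'" by (auto simp: poly_eq_0_iff_dvd)
  with Suc have "q' \<noteq> 0" by auto
  have "degree q = Suc (degree q')" unfolding q' using \<open>q' \<noteq> 0\<close> by (subst degree_mult_eq) auto
  then have deg: "n = degree q'" using Suc by simp
  obtain p where p: "p \<in> polyf X" "(\<lambda>x. 1 - p x * (y x - a)) \<in> poly_ideal X G"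
    using poly_ideal_insertD[OF inv[of a]] by blast
  \<comment> \<open>Since \<open>p\<close> inverts \<open>y - a\<close>, multiplying
    \<open>q = (y - a) q'\<close> by \<open>p\<close> gives \<open>q'\<close> up to a multiple of
    the defect \<open>1 - p (y - a)\<close>.\<close>
  have "(\<lambda>x. p x * poly q (y x) + poly q' (y x) * (1 - p x * (y x - a))) \<in> poly_ideal X G"
    using Suc.prems p y by (intro poly_ideal_add poly_ideal_mult polyf_poly) auto
  also have "(\<lambda>x. p x * poly q (y x) + poly q' (y x) * (1 - p x * (y x - a))) = (\<lambda>x. poly q' (y x))"
    by (simp add: q' algebra_simps)
  finally show ?case using Suc.hyps(1)[OF deg] \<open>q' \<noteq> 0\<close> by blast
qed

text \<open>Otherwise all \<open>y - a\<close> would be invertible modulo the ideal. Their uncountably many inverses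
  live in a space of countable dimension, and a linear relation between them, cleared of
  denominators, puts a nonzero polynomial in \<open>y\<close> into the ideal.\<close>
lemma proper_ideal_extend_value:
  assumes "finite X" and y: "y \<in> polyf X" and proper: "(\<lambda>x. 1) \<notin> poly_ideal X G"
  shows "\<exists>a. (\<lambda>x. 1) \<notin> poly_ideal X (insert (\<lambda>x. y x - a) G)"
proof (rule ccontr)
  assume "\<not> ?thesis"
  then have inv: "(\<lambda>x. 1) \<in> poly_ideal X (insert (\<lambda>x. y x - a) G)" for a by blast
  have "\<forall>a. \<exists>p. p \<in> polyf X \<and> (\<lambda>x. 1 - p x * (y x - a)) \<in> poly_ideal X G"
    using poly_ideal_insertD[OF inv] by blast
  then obtain p where p: "\<And>a. p a \<in> polyf X" "\<And>a. (\<lambda>x. 1 - p a x * (y x - a)) \<in> poly_ideal X G"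
    by metis
  define B where "B n = {A. set_mset A \<subseteq> X \<and> size A \<le> n}" for n
  have "\<forall>a. \<exists>n. p a \<in> mono_span (B n)"
    using polyf_bounded_degree[OF p(1)] by (simp add: B_def)
  then obtain n where n: "\<And>a. p a \<in> mono_span (B (n a))" by metis
  \<comment> \<open>There are uncountably many \<open>a\<close> but only countably many degree
    bounds, so one bound serves infinitely many inverses.\<close>
  have "\<exists>k. infinite {a. n a = k}"
  proof (rule ccontr)
    assume "\<not> ?thesis"
    then have "countable (\<Union>k. {a. n a = k})" by (intro countable_UN) (auto intro: countable_finite)
    moreover have "(\<Union>k. {a. n a = k}) = UNIV" by auto
    ultimately show False using uncountable_UNIV_complex by simp
  qed
  then obtain k where k: "infinite {a. n a = k}" by blast
  have finB: "finite (B k)" unfolding B_def using assms(1) by (rule finite_msets_bounded_size)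
  \<comment> \<open>One point more than there are monomials of bounded degree forces a linear
    relation between the inverses.\<close>
  obtain S where S: "finite S" "card S = Suc (card (B k))" "S \<subseteq> {a. n a = k}"
    using infinite_arbitrarily_large[OF k] by blast
  have "\<forall>a\<in>S. \<exists>m. \<forall>x. p a x = (\<Sum>A\<in>B k. m A * mono_fun A x)"
  proof
    fix a assume "a \<in> S"
    then have "p a \<in> mono_span (B k)" using n[of a] S(3) by auto
    then show "\<exists>m. \<forall>x. p a x = (\<Sum>A\<in>B k. m A * mono_fun A x)" using finB by (rule mono_span_coeffs)
  qed
  then obtain m where m: "\<And>a x. a \<in> S \<Longrightarrow> p a x = (\<Sum>A\<in>B k. m a A * mono_fun A x)" by metis
  obtain c where c: "\<exists>a\<in>S. c a \<noteq> 0" "\<forall>A\<in>B k. (\<Sum>a\<in>S. c a * m a A) = 0"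
    using underdetermined_system[OF finB S(1), of m] S(2) by auto
  have rel: "(\<Sum>a\<in>S. c a * p a x) = 0" for x
  proof -
    have "(\<Sum>a\<in>S. c a * p a x) = (\<Sum>a\<in>S. \<Sum>A\<in>B k. c a * m a A * mono_fun A x)"
      by (intro sum.cong) (simp_all add: m sum_distrib_left mult.assoc)
    also have "\<dots> = (\<Sum>A\<in>B k. (\<Sum>a\<in>S. c a * m a A) * mono_fun A x)"
      by (subst sum.swap) (simp add: sum_distrib_right)
    finally show ?thesis using c(2) by simp
  qed
  \<comment> \<open>The numerator of the sum of \<open>c a / (y - a)\<close> over the common
    denominator. At a point \<open>a\<close> of \<open>S\<close> only the summand of
    \<open>a\<close> survives, so \<open>q\<close> is nonzero as soon as some \<open>c a\<close>
    is.\<close>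
  define q where "q = (\<Sum>a\<in>S. smult (c a) (\<Prod>b\<in>S - {a}. [:-b, 1:]))"
  have poly_q: "poly q z = (\<Sum>a\<in>S. c a * (\<Prod>b\<in>S - {a}. z - b))" for z
    by (simp add: q_def poly_sum poly_prod)
  have "(\<lambda>x. poly q (y x)) \<in> poly_ideal X G"
  proof -
    have "(\<lambda>x. \<Sum>a\<in>S. poly (smult (c a) (\<Prod>b\<in>S - {a}. [:-b, 1:])) (y x) * (1 - p a x * (y x - a)))
        \<in> poly_ideal X G"
      using S(1) p y by (intro poly_ideal_sum poly_ideal_mult polyf_poly) auto
    also have "(\<lambda>x. \<Sum>a\<in>S. poly (smult (c a) (\<Prod>b\<in>S - {a}. [:-b, 1:])) (y x) * (1 - p a x * (y x - a)))
        = (\<lambda>x. poly q (y x))"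
    proof
      fix x
      have "(\<Sum>a\<in>S. c a * (\<Prod>b\<in>S - {a}. y x - b) * (p a x * (y x - a)))
          = (\<Sum>a\<in>S. (\<Prod>b\<in>S. y x - b) * (c a * p a x))"
        using S(1) by (intro sum.cong) (simp_all add: prod.remove)
      also have "\<dots> = 0" by (simp add: rel flip: sum_distrib_left)
      finally show "(\<Sum>a\<in>S. poly (smult (c a) (\<Prod>b\<in>S - {a}. [:-b, 1:])) (y x) * (1 - p a x * (y x - a)))
        = poly q (y x)"
        by (simp add: poly_q poly_prod right_diff_distrib sum_subtractf)
    qed
    finally show ?thesis .
  qed
  moreover have "q \<noteq> 0"
  proof -
    obtain a where a: "a \<in> S" "c a \<noteq> 0" using c(1) by blast
    have "poly q a = c a * (\<Prod>b\<in>S - {a}. a - b)"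
    proof -
      have "(\<Prod>b\<in>S - {a'}. a - b) = 0" if "a' \<in> S - {a}" for a'
        using that a(1) S(1) by (intro prod_zero) auto
      then have "(\<Sum>a'\<in>S - {a}. c a' * (\<Prod>b\<in>S - {a'}. a - b)) = 0" by (intro sum.neutral) auto
      then show ?thesis using a(1) S(1) unfolding poly_q by (subst sum.remove[of S a]) auto
    qed
    then show ?thesis using a S(1) by auto
  qed
  ultimately show False using poly_ideal_univariate[OF y inv] proper by blast
qed

text \<open>Telescoping: one variable at a time is replaced by its value, at the cost of a multiple
  of a generator.\<close>

lemma mono_fun_diff_value:
  assumes "set_mset A \<subseteq> X" "\<And>w. w \<in> X \<Longrightarrow> (\<lambda>x. x w - a w) \<in> G"
  shows "(\<lambda>x. mono_fun A x - mono_fun A a) \<in> poly_ideal X G"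
  using assms(1)
proof (induction A)
  case empty
  then show ?case by (simp add: poly_ideal.zero)
next
  case (add w A)
  have "(\<lambda>x. a w * (mono_fun A x - mono_fun A a) + mono_fun A x * (x w - a w)) \<in> poly_ideal X G"
    using add
    by (intro poly_ideal_add poly_ideal_mult polyf_const mono_fun_in_polyf poly_ideal_base[OF assms(2)]) auto
  then show ?case by (simp add: algebra_simps)
qed

lemma polyf_diff_value:
  assumes "f \<in> polyf X" "\<And>w. w \<in> X \<Longrightarrow> (\<lambda>x. x w - a w) \<in> G"
  shows "(\<lambda>x. f x - f a) \<in> poly_ideal X G"
  using assms(1) unfolding polyf_def
proof (induction rule: mono_span.induct)
  case zero
  then show ?case by (simp add: poly_ideal.zero)
next
  case (step f A c)
  have "(\<lambda>x. (f x - f a) + c * (mono_fun A x - mono_fun A a)) \<in> poly_ideal X G"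
    using step assms(2)
    by (intro poly_ideal_add poly_ideal_mult[OF mono_fun_diff_value] polyf_const) auto
  then show ?case by (simp add: algebra_simps)
qed

text \<open>The variables receive values one after the other while the ideal stays proper. Once all
  are fixed, every polynomial is congruent to its value at \<open>a\<close>, so a generator with
  nonzero value would put a nonzero constant into the ideal.\<close>

theorem weak_nullstellensatz:
  assumes "finite X" "G \<subseteq> polyf X" "(\<lambda>x. 1) \<notin> poly_ideal X G"
  shows "\<exists>a. \<forall>g\<in>G. g a = 0"
proof -
  have "\<exists>a. (\<lambda>x. 1) \<notin> poly_ideal X (G \<union> (\<lambda>w x. x w - a w) ` W)" if "W \<subseteq> X" for W
    using finite_subset[OF that assms(1)] that
  proof (induction W rule: finite_induct)
    case empty
    then show ?case using assms(3) by simp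
  next
    case (insert w W)
    then obtain a where a: "(\<lambda>x. 1) \<notin> poly_ideal X (G \<union> (\<lambda>w x. x w - a w) ` W)" by auto
    obtain b where b: "(\<lambda>x. 1) \<notin> poly_ideal X (insert (\<lambda>x. x w - b) (G \<union> (\<lambda>w x. x w - a w) ` W))"
      using proper_ideal_extend_value[OF assms(1) polyf_var a] insert.prems by blast
    have "(\<lambda>u x. x u - (a(w := b)) u) ` W = (\<lambda>u x. x u - a u) ` W"
      using insert.hyps by (intro image_cong) auto
    with b show ?case by (intro exI[of _ "a(w := b)"]) (simp add: insert_commute)
  qed
  then obtain a where a: "(\<lambda>x. 1) \<notin> poly_ideal X (G \<union> (\<lambda>w x. x w - a w) ` X)" (is "_ \<notin> poly_ideal X ?G")
    by blast
  have "g a = 0" if "g \<in> G" for g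
  proof (rule ccontr)
    assume nz: "g a \<noteq> 0"
    have "(\<lambda>x. g x - (g x - g a)) \<in> poly_ideal X ?G"
      using that assms(2) by (intro poly_ideal_diff poly_ideal_base polyf_diff_value) auto
    from poly_ideal_mult[OF this polyf_const[of "1 / g a"]] show False using a nz by simp
  qed
  then show ?thesis by blast
qed

section \<open>Sparse bilinear systems\<close>

text \<open>The variables \<open>(v, r)\<close> are homogeneous coordinates, one projective space
  per vertex \<open>v\<close>; this is one component of the multidegree.\<close>

definition block_degree :: "'v \<Rightarrow> ('v \<times> nat) multiset \<Rightarrow> nat" where
  "block_degree v A = size (filter_mset (\<lambda>a. fst a = v) A)"

lemma block_degree_simps [simp]:
  "block_degree v {#} = 0"
  "block_degree v (add_mset a A) = block_degree v A + (if fst a = v then 1 else 0)"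
  "block_degree v (A + B) = block_degree v A + block_degree v B"
  by (simp_all add: block_degree_def)

text \<open>\<open>c\<close> selects an affine chart of the product of projective spaces, namely the
  coordinate of each vertex to be set to 1. For \<open>W = V\<close> the monomial is nonzero exactly
  on that chart.\<close>

definition chart_mset :: "('v \<Rightarrow> nat) \<Rightarrow> 'v set \<Rightarrow> ('v \<times> nat) multiset" where
  "chart_mset c W = mset_set ((\<lambda>v. (v, c v)) ` W)"

lemma block_degree_chart_mset [simp]:
  assumes "finite W"
  shows "block_degree v (chart_mset c W) = (if v \<in> W then 1 else 0)"
proof -
  have "block_degree v (chart_mset c W) = card {a \<in> (\<lambda>v. (v, c v)) ` W. fst a = v}"
    using assms by (simp add: block_degree_def chart_mset_def)
  also have "{a \<in> (\<lambda>v. (v, c v)) ` W. fst a = v} = (if v \<in> W then {(v, c v)} else {})" by auto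
  finally show ?thesis by simp
qed

lemma mono_fun_chart_mset: "mono_fun (chart_mset c W) x = (\<Prod>v\<in>W. x (v, c v))"
proof -
  have "inj_on (\<lambda>v. (v, c v)) W" by (auto simp: inj_on_def)
  then show ?thesis
    by (simp add: mono_fun_def chart_mset_def prod.reindex flip: prod_unfold_prod_mset)
qed

lemma mono_fun_chart_mset_remove:
  assumes "finite V" "v \<in> V"
  shows "x (v, c v) * mono_fun (chart_mset c (V - {v})) x = mono_fun (chart_mset c V) x"
  using assms by (simp add: mono_fun_chart_mset prod.remove)

lemma mono_fun_repeat_mset: "mono_fun (repeat_mset n A) x = mono_fun A x ^ n"
  by (induction n) simp_all

locale bilinear_system =
  fixes V :: "'v set" and N :: "'v \<Rightarrow> nat" and E :: "('v \<times> 'v) set"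
    and H :: "'v \<times> 'v \<Rightarrow> nat \<Rightarrow> nat \<Rightarrow> complex"
  assumes finite_V: "finite V" and E_subset: "E \<subseteq> V \<times> V" and N_pos: "\<And>v. v \<in> V \<Longrightarrow> N v \<ge> 1"
begin

definition vars :: "('v \<times> nat) set" where
  "vars = (SIGMA v:V. {..<N v})"

definition form :: "'v \<times> 'v \<Rightarrow> ('v \<times> nat \<Rightarrow> complex) \<Rightarrow> complex" where
  "form e x = (\<Sum>r<N (fst e). \<Sum>c<N (snd e). x (fst e, r) * H e r c * x (snd e, c))"

definition solvable :: bool where
  "solvable \<longleftrightarrow> (\<exists>x. (\<forall>v\<in>V. \<exists>r<N v. x (v, r) \<noteq> 0) \<and> (\<forall>e\<in>E. form e x = 0))"

definition multihom :: "nat \<Rightarrow> ('v \<times> nat) multiset set" where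
  "multihom k = {A. set_mset A \<subseteq> vars \<and> (\<forall>v\<in>V. block_degree v A = k)}"

definition charts :: "('v \<Rightarrow> nat) set" where
  "charts = (\<Pi>\<^sub>E v\<in>V. {..<N v})"

lemma chartsD: "c \<in> charts \<Longrightarrow> v \<in> V \<Longrightarrow> c v < N v"
  by (auto simp: charts_def)

lemma finite_vars: "finite vars"
  using finite_V by (auto simp: vars_def)

lemma finite_E: "finite E"
  using finite_V E_subset finite_subset by blast

lemma E_in_V: "e \<in> E \<Longrightarrow> fst e \<in> V" "e \<in> E \<Longrightarrow> snd e \<in> V"
  using E_subset by auto

lemma finite_charts: "finite charts"
  unfolding charts_def using finite_V by (intro finite_PiE) auto

lemma set_chart_mset: "c \<in> charts \<Longrightarrow> W \<subseteq> V \<Longrightarrow> set_mset (chart_mset c W) \<subseteq> vars"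
  using finite_V finite_subset[of W V] by (auto simp: chart_mset_def vars_def chartsD)

lemma chart_in_multihom: "c \<in> charts \<Longrightarrow> chart_mset c V \<in> multihom 1"
  using set_chart_mset[of c V] finite_V by (simp add: multihom_def)

lemma multihom_add: "A \<in> multihom j \<Longrightarrow> B \<in> multihom k \<Longrightarrow> A + B \<in> multihom (j + k)"
  by (auto simp: multihom_def)

lemma empty_in_multihom: "{#} \<in> multihom 0"
  by (simp add: multihom_def)

lemma multihom_repeat: "A \<in> multihom j \<Longrightarrow> repeat_mset n A \<in> multihom (n * j)"
  by (induction n) (auto intro: empty_in_multihom multihom_add)

lemma size_eq_sum_block_degree:
  "set_mset A \<subseteq> vars \<Longrightarrow> size A = (\<Sum>v\<in>V. block_degree v A)"
proof (induction A)
  case (add a A)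
  then have "fst a \<in> V" by (auto simp: vars_def)
  then show ?case using add finite_V by (simp add: sum.distrib)
qed simp

lemma block_degree_eq_sum_count:
  "set_mset A \<subseteq> vars \<Longrightarrow> block_degree v A = (\<Sum>r<N v. count A (v, r))"
proof (induction A)
  case (add a A)
  obtain u s where a: "a = (u, s)" by fastforce
  have "(\<Sum>r<N v. count (add_mset a A) (v, r)) =
      (\<Sum>r<N v. count A (v, r) + (if r = s then if u = v then 1 else 0 else 0))"
    by (intro sum.cong) (auto simp: a)
  also have "\<dots> = (\<Sum>r<N v. count A (v, r)) + (if u = v then 1 else 0)"
    using add.prems a by (subst sum.distrib) (auto simp: vars_def)
  finally show ?case using add by (simp add: a)
qed simp

lemma finite_multihom: "finite (multihom k)"
proof (rule finite_subset)
  show "multihom k \<subseteq> {A. set_mset A \<subseteq> vars \<and> size A \<le> card V * k}"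
    using size_eq_sum_block_degree by (auto simp: multihom_def)
  show "finite {A. set_mset A \<subseteq> vars \<and> size A \<le> card V * k}"
    by (rule finite_msets_bounded_size[OF finite_vars])
qed

lemma form_in_polyf:
  assumes "e \<in> E"
  shows "form e \<in> polyf vars"
proof -
  have "(\<lambda>x. \<Sum>r<N (fst e). \<Sum>c<N (snd e). x (fst e, r) * H e r c * x (snd e, c)) \<in> polyf vars"
    unfolding polyf_def
    by (intro mono_span_sum; (intro mono_span_sum)?;
        (intro polyf_mult[unfolded polyf_def] polyf_const[unfolded polyf_def] polyf_var[unfolded polyf_def])?)
      (use E_in_V[OF assms] in \<open>auto simp: vars_def\<close>)
  then show ?thesis by (simp add: form_def[abs_def])
qed

section \<open>Affine charts and homogenisation\<close>

definition normalise :: "('v \<Rightarrow> nat) \<Rightarrow> ('v \<times> nat \<Rightarrow> complex) \<Rightarrow> 'v \<times> nat \<Rightarrow> complex" where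
  "normalise c x a = x a / x (fst a, c (fst a))"

text \<open>Multiplying the quotient of \<open>x (v, r)\<close> by its chart coordinate with the
  product of all chart coordinates trades the factor at \<open>v\<close> for \<open>x (v, r)\<close>
  and leaves a monomial of multidegree 1. The spare power \<open>j\<close> lets monomials of
  different sizes reach the same multidegree.\<close>

lemma homogenise_mono:
  assumes "c \<in> charts" "set_mset A \<subseteq> vars"
  shows "\<exists>B\<in>multihom (size A + j). \<forall>x. (\<forall>v\<in>V. x (v, c v) \<noteq> 0) \<longrightarrow>
    mono_fun B x = mono_fun (chart_mset c V) x ^ (size A + j) * mono_fun A (normalise c x)"
  using assms(2)
proof (induction A)
  case empty
  show ?case
    using multihom_repeat[OF chart_in_multihom[OF assms(1)], of j]
    by (intro bexI[of _ "repeat_mset j (chart_mset c V)"]) (auto simp: mono_fun_repeat_mset)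
next
  case (add a A)
  obtain v r where a: "a = (v, r)" by fastforce
  have vr: "v \<in> V" "r < N v" using add.prems a by (auto simp: vars_def)
  obtain B where B: "B \<in> multihom (size A + j)" "\<forall>x. (\<forall>v\<in>V. x (v, c v) \<noteq> 0) \<longrightarrow>
    mono_fun B x = mono_fun (chart_mset c V) x ^ (size A + j) * mono_fun A (normalise c x)"
    using add by auto
  have "add_mset a (chart_mset c (V - {v})) \<in> multihom 1"
    using vr finite_V set_chart_mset[OF assms(1), of "V - {v}"] a
    by (auto simp: multihom_def vars_def)
  from multihom_add[OF this B(1)]
  have "add_mset a (chart_mset c (V - {v})) + B \<in> multihom (size (add_mset a A) + j)" by simp
  moreover have "mono_fun (add_mset a (chart_mset c (V - {v})) + B) x =
      mono_fun (chart_mset c V) x ^ (size (add_mset a A) + j) * mono_fun (add_mset a A) (normalise c x)"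
    if x: "\<forall>v\<in>V. x (v, c v) \<noteq> 0" for x
  proof -
    have "mono_fun (chart_mset c V) x * normalise c x a = x a * mono_fun (chart_mset c (V - {v})) x"
      using x vr by (simp add: a normalise_def flip: mono_fun_chart_mset_remove[OF finite_V vr(1), of x c])
    then show ?thesis using B(2) x by (simp add: algebra_simps)
  qed
  ultimately show ?case by blast
qed

text \<open>It suffices that \<open>k\<close> is at least the size of every monomial of
  \<open>p\<close>. The eventual form lets finitely many polynomials share one
  \<open>k\<close>.\<close>

lemma homogenise:
  assumes "c \<in> charts" "p \<in> polyf vars"
  shows "\<forall>\<^sub>F k in sequentially. \<exists>q\<in>mono_span (multihom k). \<forall>x. (\<forall>v\<in>V. x (v, c v) \<noteq> 0) \<longrightarrow>
    q x = mono_fun (chart_mset c V) x ^ k * p (normalise c x)"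
  using assms(2) unfolding polyf_def
proof (induction rule: mono_span.induct)
  case zero
  show ?case by (intro always_eventually allI bexI[of _ "\<lambda>x. 0"]) (auto intro: mono_span.zero)
next
  case (step f A d)
  from step.IH eventually_ge_at_top[of "size A"] show ?case
  proof eventually_elim
    case (elim k)
    then obtain q where q: "q \<in> mono_span (multihom k)" "\<forall>x. (\<forall>v\<in>V. x (v, c v) \<noteq> 0) \<longrightarrow>
      q x = mono_fun (chart_mset c V) x ^ k * f (normalise c x)" by blast
    have "size A + (k - size A) = k" using elim by simp
    then obtain B where "B \<in> multihom k" "\<forall>x. (\<forall>v\<in>V. x (v, c v) \<noteq> 0) \<longrightarrow>
        mono_fun B x = mono_fun (chart_mset c V) x ^ k * mono_fun A (normalise c x)"
      using homogenise_mono[OF assms(1), of A "k - size A"] step.hyps(2) by auto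
    with q show ?case
      by (intro bexI[of _ "\<lambda>x. q x + d * mono_fun B x"] mono_span.step) (auto simp: algebra_simps)
  qed
qed

text \<open>The generators \<open>x (v, c v) - 1\<close> vanish on the chart, so only multiples of
  the forms remain there.\<close>

lemma chart_ideal_coeffs:
  assumes "f \<in> poly_ideal vars (form ` E \<union> (\<lambda>v x. x (v, c v) - 1) ` V)"
  shows "\<exists>p. (\<forall>e\<in>E. p e \<in> polyf vars) \<and>
    (\<forall>z. (\<forall>v\<in>V. z (v, c v) = 1) \<longrightarrow> f z = (\<Sum>e\<in>E. p e z * form e z))"
  using assms
proof (induction rule: poly_ideal.induct)
  case zero
  show ?case by (intro exI[of _ "\<lambda>_ _. 0"]) (auto intro: polyf_const)
next
  case (step f q g)
  then obtain p where p: "\<forall>e\<in>E. p e \<in> polyf vars"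
    "\<forall>z. (\<forall>v\<in>V. z (v, c v) = 1) \<longrightarrow> f z = (\<Sum>e\<in>E. p e z * form e z)" by blast
  from step.hyps(3) show ?case
  proof
    assume "g \<in> form ` E"
    then obtain e where e: "e \<in> E" "g = form e" by blast
    define p' where "p' = p(e := (\<lambda>x. p e x + q x))"
    have "(\<Sum>e\<in>E. p' e z * form e z) = (\<Sum>e\<in>E. p e z * form e z) + q z * form e z" for z
    proof -
      have "(\<Sum>e'\<in>E - {e}. p' e' z * form e' z) = (\<Sum>e'\<in>E - {e}. p e' z * form e' z)"
        by (intro sum.cong) (auto simp: p'_def)
      then show ?thesis using e finite_E by (simp add: sum.remove p'_def algebra_simps)
    qed
    moreover have "\<forall>e\<in>E. p' e \<in> polyf vars"
      using p(1) step.hyps(2) e by (auto simp: p'_def intro: polyf_add)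
    ultimately show ?thesis using p(2) e by (intro exI[of _ p']) auto
  next
    assume "g \<in> (\<lambda>v x. x (v, c v) - 1) ` V"
    then show ?thesis using p by (intro exI[of _ p]) auto
  qed
qed

text \<open>A common zero of the forms and the chart equations would solve the system, because a
  coordinate equal to 1 keeps its block nonzero. So the Nullstellensatz puts 1 into the ideal of
  each chart.\<close>

lemma chart_partition_of_unity:
  assumes "\<not> solvable" "c \<in> charts"
  shows "\<exists>p. (\<forall>e\<in>E. p e \<in> polyf vars) \<and>
    (\<forall>z. (\<forall>v\<in>V. z (v, c v) = 1) \<longrightarrow> (\<Sum>e\<in>E. p e z * form e z) = 1)"
proof -
  let ?G = "form ` E \<union> (\<lambda>v x. x (v, c v) - 1) ` V"
  have "?G \<subseteq> polyf vars"
  proof -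
    have "(v, c v) \<in> vars" if "v \<in> V" for v using chartsD[OF assms(2) that] that by (simp add: vars_def)
    then show ?thesis by (auto intro!: form_in_polyf polyf_diff polyf_var polyf_const)
  qed
  moreover have "\<nexists>a. \<forall>g\<in>?G. g a = 0"
  proof
    assume "\<exists>a. \<forall>g\<in>?G. g a = 0"
    then obtain a where a: "\<forall>g\<in>?G. g a = 0" by blast
    have "a (v, c v) \<noteq> 0" if "v \<in> V" for v
      using a that by (force simp: ball_Un)
    moreover have "form e a = 0" if "e \<in> E" for e using a that by blast
    ultimately have solvable
      unfolding solvable_def using chartsD[OF assms(2)] by (intro exI[of _ a]) blast
    with assms(1) show False by simp
  qed
  ultimately have "(\<lambda>x. 1) \<in> poly_ideal vars ?G"
    using weak_nullstellensatz[OF finite_vars] by blast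
  from chart_ideal_coeffs[OF this] obtain p where "\<forall>e\<in>E. p e \<in> polyf vars"
    "\<forall>z. (\<forall>v\<in>V. z (v, c v) = 1) \<longrightarrow> 1 = (\<Sum>e\<in>E. p e z * form e z)" by blast
  then show ?thesis by (intro exI[of _ p]) simp
qed

lemma form_normalise:
  assumes "e \<in> E" "\<forall>v\<in>V. x (v, c v) \<noteq> 0"
  shows "form e (normalise c x) * (x (fst e, c (fst e)) * x (snd e, c (snd e))) = form e x"
proof -
  have nz: "x (fst e, c (fst e)) \<noteq> 0" "x (snd e, c (snd e)) \<noteq> 0" using assms(2) E_in_V[OF assms(1)] by auto
  show ?thesis
    unfolding form_def sum_distrib_right
    by (intro sum.cong refl) (use nz in \<open>simp add: normalise_def\<close>)
qed

text \<open>A large power of the chart monomial clears the denominators in the identity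
  \<open>1 = (\<Sum>e\<in>E. p e z * form e z)\<close>. The second conclusion records the
  multidegree of \<open>s e\<close> indirectly: a product with one coordinate from each end of
  \<open>e\<close> has multidegree \<open>L\<close>, as the perturbing products will.\<close>

lemma chart_power_in_ideal:
  assumes "\<not> solvable"
  shows "\<exists>L>0. \<forall>c\<in>charts. \<exists>s. (\<forall>x. mono_fun (chart_mset c V) x ^ L = (\<Sum>e\<in>E. s e x * form e x)) \<and>
    (\<forall>e\<in>E. \<forall>r<N (fst e). \<forall>t<N (snd e).
       (\<lambda>x. s e x * mono_fun {#(fst e, r), (snd e, t)#} x) \<in> mono_span (multihom L))"
proof -
  have "\<forall>c\<in>charts. \<exists>p. (\<forall>e\<in>E. p e \<in> polyf vars) \<and>
      (\<forall>z. (\<forall>v\<in>V. z (v, c v) = 1) \<longrightarrow> (\<Sum>e\<in>E. p e z * form e z) = 1)"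
    using chart_partition_of_unity[OF assms] by blast
  from bchoice[OF this] obtain p where p: "\<And>c e. c \<in> charts \<Longrightarrow> e \<in> E \<Longrightarrow> p c e \<in> polyf vars"
    "\<And>c z. c \<in> charts \<Longrightarrow> \<forall>v\<in>V. z (v, c v) = 1 \<Longrightarrow> (\<Sum>e\<in>E. p c e z * form e z) = 1"
    by blast
  have "\<forall>\<^sub>F k in sequentially. \<forall>c\<in>charts. \<forall>e\<in>E. \<exists>q\<in>mono_span (multihom k).
      \<forall>x. (\<forall>v\<in>V. x (v, c v) \<noteq> 0) \<longrightarrow> q x = mono_fun (chart_mset c V) x ^ k * p c e (normalise c x)"
    using homogenise p(1) finite_charts finite_E by (intro eventually_ball_finite ballI) auto
  then obtain k where k: "\<forall>c\<in>charts. \<forall>e\<in>E. \<exists>q\<in>mono_span (multihom k).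
      \<forall>x. (\<forall>v\<in>V. x (v, c v) \<noteq> 0) \<longrightarrow> q x = mono_fun (chart_mset c V) x ^ k * p c e (normalise c x)"
    using eventually_happens'[OF sequentially_bot] by blast
  have "\<forall>ce\<in>charts \<times> E. \<exists>q. q \<in> mono_span (multihom k) \<and> (\<forall>x. (\<forall>v\<in>V. x (v, fst ce v) \<noteq> 0) \<longrightarrow>
      q x = mono_fun (chart_mset (fst ce) V) x ^ k * p (fst ce) (snd ce) (normalise (fst ce) x))"
  proof
    fix ce assume "ce \<in> charts \<times> E"
    then have "fst ce \<in> charts" "snd ce \<in> E" by auto
    from k[rule_format, OF this, unfolded Bex_def]
    show "\<exists>q. q \<in> mono_span (multihom k) \<and> (\<forall>x. (\<forall>v\<in>V. x (v, fst ce v) \<noteq> 0) \<longrightarrow>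
      q x = mono_fun (chart_mset (fst ce) V) x ^ k * p (fst ce) (snd ce) (normalise (fst ce) x))" .
  qed
  from bchoice[OF this] obtain q where q0: "\<forall>ce\<in>charts \<times> E. q ce \<in> mono_span (multihom k) \<and>
      (\<forall>x. (\<forall>v\<in>V. x (v, fst ce v) \<noteq> 0) \<longrightarrow>
      q ce x = mono_fun (chart_mset (fst ce) V) x ^ k * p (fst ce) (snd ce) (normalise (fst ce) x))" ..
  have q: "q (c, e) \<in> mono_span (multihom k)"
      "\<And>x. \<forall>v\<in>V. x (v, c v) \<noteq> 0 \<Longrightarrow>
        q (c, e) x = mono_fun (chart_mset c V) x ^ k * p c e (normalise c x)"
    if "c \<in> charts" "e \<in> E" for c e
    using bspec[OF q0, of "(c, e)"] that by auto
  show ?thesis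
  proof (intro exI[of _ "k + 3"] conjI ballI)
    fix c assume c: "c \<in> charts"
    let ?m = "mono_fun (chart_mset c V)"
    \<comment> \<open>Of the three extra powers, two absorb the chart coordinates of the ends of
      \<open>e\<close> that come from \<open>form_normalise\<close>. The third makes both sides
      vanish off the chart, where nothing is known about \<open>q\<close> as an extension of
      \<open>p\<close>.\<close>
    define R where "R e = chart_mset c V + chart_mset c (V - {fst e}) + chart_mset c (V - {snd e})" for e
    define s where "s e x = q (c, e) x * mono_fun (R e) x" for e x
    have "?m x ^ (k + 3) = (\<Sum>e\<in>E. s e x * form e x)" for x
    proof (cases "\<forall>v\<in>V. x (v, c v) \<noteq> 0")
      case True
      have "s e x * form e x = ?m x ^ (k + 3) * (p c e (normalise c x) * form e (normalise c x))"
        if e: "e \<in> E" for e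
      proof -
        have "s e x * form e x = q (c, e) x * ?m x * form e (normalise c x) *
            (x (fst e, c (fst e)) * mono_fun (chart_mset c (V - {fst e})) x) *
            (x (snd e, c (snd e)) * mono_fun (chart_mset c (V - {snd e})) x)"
          unfolding s_def R_def form_normalise[OF e True, symmetric] by simp
        then show ?thesis
          using E_in_V[OF e] q(2)[OF c e True]
          by (simp add: mono_fun_chart_mset_remove[OF finite_V] power_add power3_eq_cube)
      qed
      then have "(\<Sum>e\<in>E. s e x * form e x) =
          ?m x ^ (k + 3) * (\<Sum>e\<in>E. p c e (normalise c x) * form e (normalise c x))"
        by (simp add: sum_distrib_left)
      also have "\<dots> = ?m x ^ (k + 3)" using True by (subst p(2)[OF c]) (auto simp: normalise_def)
      finally show ?thesis by simp
    next
      case False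
      then have "?m x = 0" using finite_V by (auto simp: mono_fun_chart_mset)
      then show ?thesis by (simp add: s_def R_def)
    qed
    moreover have "(\<lambda>x. s e x * mono_fun {#(fst e, r), (snd e, t)#} x) \<in> mono_span (multihom (k + 3))"
      if e: "e \<in> E" and r: "r < N (fst e)" and t: "t < N (snd e)" for e r t
    proof -
      have "R e + {#(fst e, r), (snd e, t)#} \<in> multihom 3"
        using E_in_V[OF e] r t finite_V set_chart_mset[OF c, of "V - {fst e}"] set_chart_mset[OF c, of V]
          set_chart_mset[OF c, of "V - {snd e}"]
        unfolding multihom_def R_def by (auto simp: vars_def)
      then have "(\<lambda>x. q (c, e) x * mono_fun (R e + {#(fst e, r), (snd e, t)#}) x) \<in> mono_span (multihom (k + 3))"
        by (intro mono_span_mult[OF mono_span_base q(1)[OF c e]] multihom_add)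
      then show ?thesis by (simp add: s_def ac_simps)
    qed
    ultimately show "\<exists>s. (\<forall>x. ?m x ^ (k + 3) = (\<Sum>e\<in>E. s e x * form e x)) \<and>
      (\<forall>e\<in>E. \<forall>r<N (fst e). \<forall>t<N (snd e).
         (\<lambda>x. s e x * mono_fun {#(fst e, r), (snd e, t)#} x) \<in> mono_span (multihom (k + 3)))"
      by blast
  qed simp
qed

text \<open>\<open>D\<close> exceeds \<open>L\<close> times the number of coordinates of any block,
  so a monomial of multidegree \<open>D\<close> contains some coordinate of each block at least
  \<open>L\<close> times. It is thus divisible by the \<open>L\<close>-th power of a chart monomial,
  whose identity is multiplied by the cofactor \<open>A'\<close>.\<close>

lemma monomials_in_ideal:
  assumes "\<not> solvable"
  shows "\<exists>D. \<forall>A\<in>multihom D. \<exists>s. (\<forall>x. mono_fun A x = (\<Sum>e\<in>E. s e x * form e x)) \<and>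
    (\<forall>e\<in>E. \<forall>r<N (fst e). \<forall>t<N (snd e).
       (\<lambda>x. s e x * mono_fun {#(fst e, r), (snd e, t)#} x) \<in> mono_span (multihom D))"
proof -
  obtain L where "L > 0" and L: "\<And>c. c \<in> charts \<Longrightarrow>
    \<exists>s. (\<forall>x. mono_fun (chart_mset c V) x ^ L = (\<Sum>e\<in>E. s e x * form e x)) \<and>
      (\<forall>e\<in>E. \<forall>r<N (fst e). \<forall>t<N (snd e).
         (\<lambda>x. s e x * mono_fun {#(fst e, r), (snd e, t)#} x) \<in> mono_span (multihom L))"
    using chart_power_in_ideal[OF assms] by blast
  define D where "D = L * Suc (\<Sum>v\<in>V. N v)"
  show ?thesis
  proof (intro exI[of _ D] ballI)
    fix A assume A: "A \<in> multihom D"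
    have "\<exists>r. r < N v \<and> L \<le> count A (v, r)" if v: "v \<in> V" for v
    proof (rule ccontr)
      assume "\<not> ?thesis"
      then have "(\<Sum>r<N v. count A (v, r)) \<le> (\<Sum>r<N v. L)" by (intro sum_mono) (auto simp: not_le)
      also have "\<dots> \<le> L * (\<Sum>v\<in>V. N v)" using v finite_V by (simp add: member_le_sum)
      also have "\<dots> < D" using \<open>L > 0\<close> by (simp add: D_def)
      finally show False
        using A v block_degree_eq_sum_count[of A v] by (auto simp: multihom_def)
    qed
    then obtain c0 where c0: "\<And>v. v \<in> V \<Longrightarrow> c0 v < N v \<and> L \<le> count A (v, c0 v)" by metis
    define c where "c = restrict c0 V"
    have c: "c \<in> charts" using c0 by (auto simp: c_def charts_def)
    define A' where "A' = A - repeat_mset L (chart_mset c V)"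
    have "repeat_mset L (chart_mset c V) \<subseteq># A"
      using c0 finite_V by (auto simp: subseteq_mset_def chart_mset_def count_mset_set' c_def)
    then have A_eq: "A = repeat_mset L (chart_mset c V) + A'" by (simp add: A'_def)
    have A': "A' \<in> multihom (D - L)"
    proof -
      have "repeat_mset L (chart_mset c V) \<in> multihom L"
        using multihom_repeat[OF chart_in_multihom[OF c], of L] by simp
      then have "D = L + block_degree v A'" if "v \<in> V" for v
        using A that arg_cong[OF A_eq, of "block_degree v"] by (simp add: multihom_def)
      moreover have "set_mset A' \<subseteq> set_mset A" unfolding A'_def by (meson in_diffD subsetI)
      ultimately show ?thesis using A by (fastforce simp: multihom_def)
    qed
    have "L \<le> D" by (simp add: D_def)
    obtain s where s: "\<And>x. mono_fun (chart_mset c V) x ^ L = (\<Sum>e\<in>E. s e x * form e x)"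
      "\<And>e r t. e \<in> E \<Longrightarrow> r < N (fst e) \<Longrightarrow> t < N (snd e) \<Longrightarrow>
         (\<lambda>x. s e x * mono_fun {#(fst e, r), (snd e, t)#} x) \<in> mono_span (multihom L)"
      using L[OF c] by blast
    have "mono_fun A x = (\<Sum>e\<in>E. (s e x * mono_fun A' x) * form e x)" for x
    proof -
      have "mono_fun A x = mono_fun (chart_mset c V) x ^ L * mono_fun A' x"
        unfolding A_eq by (simp add: mono_fun_repeat_mset)
      also have "\<dots> = (\<Sum>e\<in>E. (s e x * mono_fun A' x) * form e x)"
        by (simp add: s(1) sum_distrib_left sum_distrib_right algebra_simps)
      finally show ?thesis .
    qed
    moreover have "(\<lambda>x. s e x * mono_fun A' x * mono_fun {#(fst e, r), (snd e, t)#} x) \<in> mono_span (multihom D)"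
      if "e \<in> E" "r < N (fst e)" "t < N (snd e)" for e r t
    proof -
      have "(\<lambda>x. s e x * mono_fun {#(fst e, r), (snd e, t)#} x * mono_fun A' x) \<in> mono_span (multihom D)"
        using multihom_add[of _ L _ "D - L"] \<open>L \<le> D\<close>
        by (intro mono_span_mult[OF mono_span_base[OF A'] s(2)[OF that]]) simp
      then show ?thesis by (simp add: algebra_simps)
    qed
    ultimately show "\<exists>s. (\<forall>x. mono_fun A x = (\<Sum>e\<in>E. s e x * form e x)) \<and>
      (\<forall>e\<in>E. \<forall>r<N (fst e). \<forall>t<N (snd e).
         (\<lambda>x. s e x * mono_fun {#(fst e, r), (snd e, t)#} x) \<in> mono_span (multihom D))"
      by (intro exI[of _ "\<lambda>e x. s e x * mono_fun A' x"]) blast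
  qed
qed

text \<open>The monomials of a large multidegree, evaluated at a solution of the perturbed system, form an
  eigenvector of a matrix independent of \<open>\<tau>\<close>, with eigenvalue \<open>-1/\<tau>\<close>.\<close>
lemma finite_perturbed_solvable:
  assumes "\<not> solvable" and \<rho>: "\<And>e. e \<in> E \<Longrightarrow> \<rho> e < N (fst e)" and \<sigma>: "\<And>e. e \<in> E \<Longrightarrow> \<sigma> e < N (snd e)"
  shows "finite {\<tau>. \<exists>x. (\<forall>v\<in>V. x (v, 0) = 1) \<and>
    (\<forall>e\<in>E. form e x + \<tau> * (x (fst e, \<rho> e) * x (snd e, \<sigma> e)) = 0)}" (is "finite ?T")
proof -
  obtain D where D: "\<forall>A\<in>multihom D.
    \<exists>s. (\<forall>x. mono_fun A x = (\<Sum>e\<in>E. s e x * form e x)) \<and>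
      (\<forall>e\<in>E. \<forall>r<N (fst e). \<forall>t<N (snd e).
         (\<lambda>x. s e x * mono_fun {#(fst e, r), (snd e, t)#} x) \<in> mono_span (multihom D))"
    using monomials_in_ideal[OF assms(1)] ..
  from bchoice[OF D] obtain s where
    s: "\<And>A x. A \<in> multihom D \<Longrightarrow> mono_fun A x = (\<Sum>e\<in>E. s A e x * form e x)"
    "\<And>A e r t. A \<in> multihom D \<Longrightarrow> e \<in> E \<Longrightarrow> r < N (fst e) \<Longrightarrow> t < N (snd e) \<Longrightarrow>
       (\<lambda>x. s A e x * mono_fun {#(fst e, r), (snd e, t)#} x) \<in> mono_span (multihom D)"
    by blast
  \<comment> \<open>The expression for the monomial \<open>A\<close> with each form replaced by its
    perturbing product. At a solution the form is \<open>-\<tau>\<close> times that product, so the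
    monomial is \<open>-\<tau>\<close> times \<open>T A\<close>.\<close>
  define T where "T A x = (\<Sum>e\<in>E. s A e x * mono_fun {#(fst e, \<rho> e), (snd e, \<sigma> e)#} x)" for A x
  have "\<forall>A\<in>multihom D. \<exists>a. \<forall>x. T A x = (\<Sum>B\<in>multihom D. a B * mono_fun B x)"
  proof
    fix A assume A: "A \<in> multihom D"
    have "T A \<in> mono_span (multihom D)"
      unfolding T_def[abs_def] using s(2)[OF A] \<rho> \<sigma> finite_E by (intro mono_span_sum) auto
    then show "\<exists>a. \<forall>x. T A x = (\<Sum>B\<in>multihom D. a B * mono_fun B x)"
      using finite_multihom by (rule mono_span_coeffs)
  qed
  from bchoice[OF this] obtain a where
    a: "\<And>A x. A \<in> multihom D \<Longrightarrow> T A x = (\<Sum>B\<in>multihom D. a A B * mono_fun B x)"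
    by blast
  define c0 where "c0 = restrict (\<lambda>_. 0 :: nat) V"
  have c0: "c0 \<in> charts" unfolding c0_def charts_def using N_pos by force
  \<comment> \<open>A monomial in the coordinates fixed to 1. Its value 1 shows that the eigenvector
    is nonzero.\<close>
  define A0 where "A0 = repeat_mset D (chart_mset c0 V)"
  have A0: "A0 \<in> multihom D"
    using multihom_repeat[OF chart_in_multihom[OF c0], of D] by (simp add: A0_def)
  \<comment> \<open>The unit row at \<open>A0\<close> times the \<open>i\<close>-th power of the
    matrix \<open>a\<close>. Paired with the eigenvector it gives \<open>(-1 / \<tau>) ^ i\<close>,
    so a linear relation between these rows is a polynomial equation for \<open>-1 / \<tau>\<close>
    whose coefficients do not depend on \<open>\<tau>\<close>.\<close>
  define u where "u = rec_nat (\<lambda>B. if B = A0 then 1 else 0) (\<lambda>i w B. \<Sum>A\<in>multihom D. w A * a A B)"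
  define n where "n = card (multihom D)"
  obtain d where d: "\<exists>i\<in>{..n}. d i \<noteq> 0" "\<forall>B\<in>multihom D. (\<Sum>i\<in>{..n}. d i * u i B) = 0"
    using underdetermined_system[OF finite_multihom[of D], of "{..n}" u] by (auto simp: n_def)
  have poly_zero: "(\<Sum>i\<le>n. d i * (-1 / \<tau>) ^ i) = 0" if \<tau>: "\<tau> \<in> ?T" "\<tau> \<noteq> 0" for \<tau>
  proof -
    from \<tau>(1) obtain x where x: "\<forall>v\<in>V. x (v, 0) = 1"
      "\<forall>e\<in>E. form e x + \<tau> * (x (fst e, \<rho> e) * x (snd e, \<sigma> e)) = 0" by blast
    have form_x: "form e x = - \<tau> * (x (fst e, \<rho> e) * x (snd e, \<sigma> e))" if "e \<in> E" for e
      using bspec[OF x(2) that] by (simp add: eq_neg_iff_add_eq_0)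
    have "mono_fun A x = - \<tau> * T A x" if "A \<in> multihom D" for A
      unfolding s(1)[OF that] T_def sum_distrib_left by (intro sum.cong) (auto simp: form_x)
    then have eig: "T A x = (-1 / \<tau>) * mono_fun A x" if "A \<in> multihom D" for A
      using that \<tau>(2) by simp
    have u: "(\<Sum>B\<in>multihom D. u i B * mono_fun B x) = (-1 / \<tau>) ^ i" for i
    proof (induction i)
      case 0
      have "(\<Sum>B\<in>multihom D. u 0 B * mono_fun B x) = (\<Sum>B\<in>multihom D. if B = A0 then mono_fun B x else 0)"
        by (intro sum.cong) (auto simp: u_def)
      also have "\<dots> = mono_fun A0 x" using A0 finite_multihom by simp
      also have "\<dots> = 1"
        using x(1) by (simp add: A0_def mono_fun_repeat_mset mono_fun_chart_mset c0_def)
      finally show ?case by simp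
    next
      case (Suc i)
      have "(\<Sum>B\<in>multihom D. u (Suc i) B * mono_fun B x) =
          (\<Sum>B\<in>multihom D. \<Sum>A\<in>multihom D. u i A * (a A B * mono_fun B x))"
        by (simp add: u_def sum_distrib_right mult.assoc)
      also have "\<dots> = (\<Sum>A\<in>multihom D. u i A * T A x)"
        by (subst sum.swap) (simp add: a flip: sum_distrib_left)
      also have "\<dots> = (\<Sum>A\<in>multihom D. (-1 / \<tau>) * (u i A * mono_fun A x))"
        by (intro sum.cong refl) (simp only: eig, simp)
      also have "\<dots> = (-1 / \<tau>) ^ Suc i" unfolding sum_distrib_left[symmetric] Suc by simp
      finally show ?case .
    qed
    have "(\<Sum>i\<le>n. d i * (-1 / \<tau>) ^ i) = (\<Sum>i\<le>n. \<Sum>B\<in>multihom D. d i * u i B * mono_fun B x)"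
      unfolding u[symmetric] by (simp add: sum_distrib_left mult.assoc)
    also have "\<dots> = (\<Sum>B\<in>multihom D. (\<Sum>i\<le>n. d i * u i B) * mono_fun B x)"
      by (subst sum.swap) (simp add: sum_distrib_right)
    finally show ?thesis using d(2) by simp
  qed
  have "finite {z. (\<Sum>i\<le>n. d i * z ^ i) = 0}"
    using d(1) Poly_Roots.polyfun_finite_roots[of d n] by auto
  moreover have "?T \<subseteq> insert 0 ((\<lambda>z. -1 / z) ` {z. (\<Sum>i\<le>n. d i * z ^ i) = 0})"
  proof
    fix \<tau> assume \<tau>: "\<tau> \<in> ?T"
    show "\<tau> \<in> insert 0 ((\<lambda>z. -1 / z) ` {z. (\<Sum>i\<le>n. d i * z ^ i) = 0})"
    proof (cases "\<tau> = 0")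
      case False
      then have "\<tau> = -1 / (-1 / \<tau>)" by simp
      with poly_zero[OF \<tau> False] show ?thesis by blast
    qed simp
  qed
  ultimately show ?thesis using finite_subset by blast
qed

section \<open>Solutions of the perturbed system and of the original one\<close>

text \<open>Each edge has a coordinate \<open>key e\<close> of its own, so its equation can be read
  as \<open>x (key e) = - form e x / \<tau>\<close>. With index 0 coordinates equal to 1 and all
  other coordinates that are not keys equal to 0, the right-hand side is a contraction for large
  \<open>\<tau>\<close>.\<close>

lemma perturbed_solvable:
  assumes key: "inj_on key E"
    and key_E: "\<And>e. e \<in> E \<Longrightarrow> snd (key e) \<noteq> 0"
  shows "\<exists>R. \<forall>\<tau>. norm \<tau> \<ge> R \<longrightarrow> (\<exists>x. (\<forall>v. x (v, 0) = 1) \<and> (\<forall>e\<in>E. form e x + \<tau> * x (key e) = 0))"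
proof -
  define ext where "ext X a = (if snd a = 0 then 1 else if a \<in> key ` E then X (the_inv_into E key a) else 0)"
    for X :: "'v \<times> 'v \<Rightarrow> complex" and a
  have ext_key: "ext X (key e) = X e" if "e \<in> E" for X e
    using that key_E[OF that] the_inv_into_f_f[OF key that] by (simp add: ext_def)
  have ext_bd: "norm (ext X a) \<le> 1" if "\<forall>e\<in>E. norm (X e) \<le> 1" for X :: "'v \<times> 'v \<Rightarrow> complex" and a
    using that the_inv_into_into[OF key _ subset_refl] by (auto simp: ext_def)
  have ext_diff: "norm (ext X a - ext Y a) \<le> \<delta>" if "\<forall>e\<in>E. norm (X e - Y e) \<le> \<delta>" "0 \<le> \<delta>"
    for X Y :: "'v \<times> 'v \<Rightarrow> complex" and a \<delta>
    using that the_inv_into_into[OF key _ subset_refl] by (auto simp: ext_def)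
  define C where "C e = (\<Sum>r<N (fst e). \<Sum>c<N (snd e). norm (H e r c))" for e
  define B where "B = (\<Sum>e\<in>E. C e)"
  have C_nonneg: "0 \<le> C e" for e by (auto simp: C_def intro!: sum_nonneg)
  have CB: "C e \<le> B" if "e \<in> E" for e
    unfolding B_def using that finite_E C_nonneg by (intro member_le_sum) auto
  have B_nonneg: "0 \<le> B" unfolding B_def using C_nonneg by (intro sum_nonneg)
  have form_bd: "norm (form e x) \<le> C e" if "\<And>a. norm (x a) \<le> 1" for e x
    unfolding form_def C_def
  proof (intro sum_norm_le)
    fix r c
    have "norm (x (fst e, r) * H e r c * x (snd e, c)) =
        norm (H e r c) * (norm (x (fst e, r)) * norm (x (snd e, c)))" by (simp add: norm_mult)
    also have "\<dots> \<le> norm (H e r c) * 1"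
      using that by (intro mult_left_mono mult_le_one) auto
    finally show "norm (x (fst e, r) * H e r c * x (snd e, c)) \<le> norm (H e r c)" by simp
  qed
  have form_diff: "norm (form e x - form e y) \<le> C e * (2 * \<delta>)"
    if "\<And>a. norm (x a) \<le> 1" "\<And>a. norm (y a) \<le> 1" "\<And>a. norm (x a - y a) \<le> \<delta>" for e x y \<delta>
    unfolding form_def C_def sum_subtractf[symmetric] sum_distrib_right
  proof (intro sum_norm_le)
    fix r c
    have \<delta>: "0 \<le> \<delta>" using that(3) norm_ge_zero order_trans by blast
    have "x (fst e, r) * H e r c * x (snd e, c) - y (fst e, r) * H e r c * y (snd e, c) =
        H e r c * (x (fst e, r) * (x (snd e, c) - y (snd e, c)) + (x (fst e, r) - y (fst e, r)) * y (snd e, c))"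
      by (simp add: algebra_simps)
    also have "norm \<dots> \<le> norm (H e r c) *
        (norm (x (fst e, r)) * norm (x (snd e, c) - y (snd e, c)) + norm (x (fst e, r) - y (fst e, r)) * norm (y (snd e, c)))"
      unfolding norm_mult[symmetric] by (intro order_trans[OF eq_refl[OF norm_mult]] mult_left_mono norm_triangle_ineq) auto
    also have "\<dots> \<le> norm (H e r c) * (1 * \<delta> + \<delta> * 1)"
      using that \<delta> by (intro mult_left_mono add_mono mult_mono) auto
    finally show "norm (x (fst e, r) * H e r c * x (snd e, c) - y (fst e, r) * H e r c * y (snd e, c))
        \<le> norm (H e r c) * (2 * \<delta>)" by simp
  qed
  show ?thesis
  \<comment> \<open>On the polydisc the forms are bounded by \<open>B\<close> and change by at most
    \<open>2 * B\<close> times the distance, so \<open>4 * B\<close> yields the factor 1/2; the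
    extra 1 keeps \<open>\<tau>\<close> nonzero.\<close>
  proof (intro exI[of _ "4 * B + 1"] allI impI)
    fix \<tau> :: complex assume \<tau>: "4 * B + 1 \<le> norm \<tau>"
    then have \<tau>0: "norm \<tau> > 0" using B_nonneg by linarith
    define F where "F X e = - form e (ext X) / \<tau>" for X e
    have "\<exists>X. \<forall>e\<in>E. F X e = X e"
    proof (rule contraction_fixpoint)
      fix X :: "'v \<times> 'v \<Rightarrow> complex" and e assume "\<forall>e\<in>E. norm (X e) \<le> 1" "e \<in> E"
      then have "norm (form e (ext X)) \<le> B" using form_bd[of "ext X" e, OF ext_bd] CB[of e] by linarith
      also have "\<dots> \<le> norm \<tau>" using \<tau> B_nonneg by linarith
      finally show "norm (F X e) \<le> 1" using \<tau>0 by (simp add: F_def norm_divide)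
    next
      fix X Y :: "'v \<times> 'v \<Rightarrow> complex" and \<delta> e
      assume X: "\<forall>e\<in>E. norm (X e) \<le> 1" and Y: "\<forall>e\<in>E. norm (Y e) \<le> 1"
        and \<delta>: "\<forall>e\<in>E. norm (X e - Y e) \<le> \<delta>" and e: "e \<in> E"
      have \<delta>0: "0 \<le> \<delta>" using \<delta> e norm_ge_zero order_trans by blast
      have "norm (form e (ext X) - form e (ext Y)) \<le> C e * (2 * \<delta>)"
        by (intro form_diff ext_bd X Y ext_diff[OF \<delta> \<delta>0])
      also have "\<dots> \<le> B * (2 * \<delta>)" using CB[OF e] \<delta>0 by (intro mult_right_mono) auto
      also have "\<dots> = (4 * B) * (\<delta> / 2)" by simp
      also have "\<dots> \<le> norm \<tau> * (\<delta> / 2)" using \<tau> \<delta>0 by (intro mult_right_mono) auto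
      finally have "norm (form e (ext X) - form e (ext Y)) / norm \<tau> \<le> \<delta> / 2"
        using \<tau>0 by (simp add: field_simps)
      moreover have "F X e - F Y e = - (form e (ext X) - form e (ext Y)) / \<tau>"
        by (simp add: F_def diff_divide_distrib)
      ultimately show "norm (F X e - F Y e) \<le> \<delta> / 2" by (simp add: norm_divide norm_minus_commute)
    qed
    then obtain X where X: "\<And>e. e \<in> E \<Longrightarrow> F X e = X e" by blast
    have "form e (ext X) + \<tau> * ext X (key e) = 0" if "e \<in> E" for e
    proof -
      have "\<tau> * X e = - form e (ext X)" using X[OF that] \<tau>0 by (simp add: F_def field_simps)
      then show ?thesis by (simp add: ext_key[OF that])
    qed
    then show "\<exists>x. (\<forall>v. x (v, 0) = 1) \<and> (\<forall>e\<in>E. form e x + \<tau> * x (key e) = 0)"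
      by (intro exI[of _ "ext X"]) (auto simp: ext_def)
  qed
qed

text \<open>The orientation provides the keys, hence perturbed solutions for every large
  \<open>\<tau>\<close>, whereas an unsolvable system would admit only finitely many
  \<open>\<tau>\<close>.\<close>

theorem solvable_if_sparse:
  assumes sparse: "\<And>W. W \<subseteq> V \<Longrightarrow> card (E \<inter> W \<times> W) \<le> (\<Sum>v\<in>W. N v - 1)"
  shows solvable
proof (rule ccontr)
  assume unsolvable: "\<not> solvable"
  obtain own where own: "\<And>e. e \<in> E \<Longrightarrow> own e = fst e \<or> own e = snd e"
    "\<And>v. v \<in> V \<Longrightarrow> card {e \<in> E. own e = v} \<le> N v - 1"
    using bounded_orientation_exists[OF finite_E finite_V E_subset sparse] by blast
  \<comment> \<open>Index 0 is reserved for the coordinate set to 1. The remaining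
    \<open>N v - 1\<close> indices match the capacity of \<open>v\<close> in the
    orientation.\<close>
  have "\<forall>v\<in>V. \<exists>k. inj_on k {e \<in> E. own e = v} \<and> k ` {e \<in> E. own e = v} \<subseteq> {1..<N v}"
  proof
    fix v assume v: "v \<in> V"
    have "finite {e \<in> E. own e = v}" using finite_E by simp
    moreover have "card {e \<in> E. own e = v} \<le> card {1..<N v}" using own(2)[OF v] by simp
    ultimately show "\<exists>k. inj_on k {e \<in> E. own e = v} \<and> k ` {e \<in> E. own e = v} \<subseteq> {1..<N v}"
      using card_le_inj[of "{e \<in> E. own e = v}" "{1..<N v}"] by blast
  qed
  from bchoice[OF this] obtain k where k: "\<And>v. v \<in> V \<Longrightarrow> inj_on (k v) {e \<in> E. own e = v}"
    "\<And>v. v \<in> V \<Longrightarrow> k v ` {e \<in> E. own e = v} \<subseteq> {1..<N v}" by blast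
  define key where "key e = (own e, k (own e) e)" for e
  have own_V: "own e \<in> V" if "e \<in> E" for e using own(1)[OF that] E_in_V[OF that] by auto
  have key_range: "k (own e) e \<noteq> 0 \<and> k (own e) e < N (own e)" if "e \<in> E" for e
    using k(2)[OF own_V[OF that]] that by force
  have "inj_on key E"
  proof (rule inj_onI)
    fix e f assume ef: "e \<in> E" "f \<in> E" "key e = key f"
    then have "own f = own e" "k (own e) e = k (own e) f" by (auto simp: key_def)
    with ef show "e = f" by (intro inj_onD[OF k(1)[OF own_V[OF ef(1)]]]) auto
  qed
  then obtain R where R: "\<And>\<tau>. norm \<tau> \<ge> R \<Longrightarrow>
      \<exists>x. (\<forall>v. x (v, 0) = 1) \<and> (\<forall>e\<in>E. form e x + \<tau> * x (key e) = 0)"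
    using perturbed_solvable[of key] key_range by (auto simp: key_def)
  \<comment> \<open>The perturbation must have the multidegree of the form. The owned coordinate is
    therefore paired with coordinate 0 of the other end, which is 1 in the chart.\<close>
  define \<rho> where "\<rho> e = (if own e = fst e then k (own e) e else 0)" for e
  define \<sigma> where "\<sigma> e = (if own e = fst e then 0 else k (own e) e)" for e
  let ?T = "{\<tau>. \<exists>x. (\<forall>v\<in>V. x (v, 0) = 1) \<and>
    (\<forall>e\<in>E. form e x + \<tau> * (x (fst e, \<rho> e) * x (snd e, \<sigma> e)) = 0)}"
  have "finite ?T"
  proof (rule finite_perturbed_solvable[OF unsolvable])
    fix e assume e: "e \<in> E"
    show "\<rho> e < N (fst e)" "\<sigma> e < N (snd e)"
      using key_range[OF e] own(1)[OF e] N_pos E_in_V[OF e] by (auto simp: \<rho>_def \<sigma>_def Suc_le_eq)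
  qed
  moreover have "of_nat n \<in> ?T" if n: "n \<ge> nat \<lceil>R\<rceil>" for n
  proof -
    have "R \<le> norm (of_nat n :: complex)" using n by (simp add: nat_le_iff ceiling_le_iff)
    then obtain x where x: "\<forall>v. x (v, 0) = 1" "\<forall>e\<in>E. form e x + of_nat n * x (key e) = 0"
      using R by blast
    have "x (fst e, \<rho> e) * x (snd e, \<sigma> e) = x (key e)" if "e \<in> E" for e
      using own(1)[OF that] x(1) by (auto simp: \<rho>_def \<sigma>_def key_def)
    then show ?thesis using x by auto
  qed
  then have "of_nat ` {nat \<lceil>R\<rceil>..} \<subseteq> ?T" by auto
  moreover have "infinite ((of_nat :: nat \<Rightarrow> complex) ` {nat \<lceil>R\<rceil>..})"
    by (subst finite_image_iff) (auto simp: inj_on_def infinite_Ici)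
  ultimately show False using finite_subset by blast
qed

end

section \<open>Interference alignment\<close>

text \<open>Receivers and transmitters are the two sides \<open>Inl\<close> and \<open>Inr\<close>
  of a bipartite graph, so a vertex set \<open>W\<close> is a pair \<open>(R, T)\<close> and its
  capacity is \<open>N_Var\<close>. Taking the conjugate of \<open>g\<close> as unknown makes the
  equations bilinear.\<close>

lemma bipartite_system_solvable:
  fixes N M :: "nat \<Rightarrow> nat" and G :: "nat \<Rightarrow> nat \<Rightarrow> nat \<Rightarrow> nat \<Rightarrow> complex"
  assumes "finite I" "finite J" and E: "E \<subseteq> I \<times> J"
    and N: "\<And>i. i \<in> I \<Longrightarrow> N i \<ge> 1" and M: "\<And>j. j \<in> J \<Longrightarrow> M j \<ge> 1"
    and count: "\<And>R T. R \<subseteq> I \<Longrightarrow> T \<subseteq> J \<Longrightarrow> int (card (E \<inter> R \<times> T)) \<le> N_Var N M R T"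
  shows "\<exists>g t. (\<forall>i\<in>I. \<exists>r<N i. g i r \<noteq> 0) \<and> (\<forall>j\<in>J. \<exists>c<M j. t j c \<noteq> 0) \<and>
    (\<forall>i j. (i, j) \<in> E \<longrightarrow> (\<Sum>r<N i. \<Sum>c<M j. cnj (g i r) * G i j r c * t j c) = 0)"
proof -
  let ?V = "Inl ` I \<union> Inr ` J"
  let ?h = "\<lambda>(i, j). (Inl i, Inr j)"
  let ?N = "case_sum N M"
  interpret bilinear_system ?V ?N "?h ` E" "\<lambda>(a, b). G (projl a) (projr b)"
    using assms(1,2) E N M by unfold_locales auto
  have "card (?h ` E \<inter> W \<times> W) \<le> (\<Sum>v\<in>W. ?N v - 1)" if W: "W \<subseteq> ?V" for W
  proof -
    define R where "R = Inl -` W"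
    define T where "T = Inr -` W"
    have RT: "R \<subseteq> I" "T \<subseteq> J" using W by (auto simp: R_def T_def)
    have fin: "finite R" "finite T" using RT assms(1,2) finite_subset by auto
    have W_eq: "W = Inl ` R \<union> Inr ` T"
      using W by (auto simp: R_def T_def)
    have "?h ` E \<inter> W \<times> W = ?h ` (E \<inter> R \<times> T)" by (auto simp: R_def T_def)
    moreover have "card (?h ` (E \<inter> R \<times> T)) = card (E \<inter> R \<times> T)"
      by (rule card_image) (auto simp: inj_on_def)
    ultimately have "int (card (?h ` E \<inter> W \<times> W)) = int (card (E \<inter> R \<times> T))" by simp
    also have "\<dots> \<le> N_Var N M R T" using count RT by blast
    also have "\<dots> = (\<Sum>i\<in>R. int (N i - 1)) + (\<Sum>j\<in>T. int (M j - 1))"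
      unfolding N_Var_def using RT N M by (intro arg_cong2[of _ _ _ _ "(+)"] sum.cong) (auto simp: of_nat_diff)
    also have "\<dots> = int (\<Sum>v\<in>W. ?N v - 1)"
      unfolding W_eq using fin by (subst sum.union_disjoint) (auto simp: sum.reindex)
    finally show ?thesis by linarith
  qed
  then have solvable by (rule solvable_if_sparse)
  then obtain x where x: "\<forall>v\<in>?V. \<exists>r<?N v. x (v, r) \<noteq> 0" "\<forall>e\<in>?h ` E. form e x = 0"
    unfolding solvable_def by blast
  have "(\<Sum>r<N i. \<Sum>c<M j. cnj (cnj (x (Inl i, r))) * G i j r c * x (Inr j, c)) = 0" if "(i, j) \<in> E" for i j
    using x(2) that by (force simp: form_def)
  then show ?thesis
    using x(1) by (intro exI[where x = "\<lambda>i r. cnj (x (Inl i, r))"] exI[where x = "\<lambda>j c. x (Inr j, c)"])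
      (auto simp: ball_Un)
qed

lemma choice2: "\<forall>x. \<exists>y z. P x y z \<Longrightarrow> \<exists>f g. \<forall>x. P x (f x) (g x)"
  by metis

text \<open>Feasibility for \<open>(R \<union> SR, T \<union> ST)\<close> minus the equality for
  \<open>(SR, ST)\<close>. Users whose vectors are already fixed contribute no further variables,
  which the antenna number 1 encodes.\<close>

lemma residual_count:
  assumes "finite U" "SR \<subseteq> U" "ST \<subseteq> U" "R \<subseteq> U" "T \<subseteq> U"
    and feasible: "\<And>R T. R \<subseteq> U \<Longrightarrow> T \<subseteq> U \<Longrightarrow> N_Eq R T \<le> N_Var N M R T"
    and tight: "N_Var N M SR ST = N_Eq SR ST"
  shows "int (card ({(i, j). i \<in> U \<and> j \<in> U \<and> i \<noteq> j \<and> \<not> (i \<in> SR \<and> j \<in> ST)} \<inter> R \<times> T)) \<le>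
    N_Var (\<lambda>i. if i \<in> SR then 1 else N i) (\<lambda>j. if j \<in> ST then 1 else M j) R T"
proof -
  let ?E = "{(i, j). i \<in> U \<and> j \<in> U \<and> i \<noteq> j \<and> \<not> (i \<in> SR \<and> j \<in> ST)} \<inter> R \<times> T"
  let ?E1 = "{(i, j). i \<in> SR \<and> j \<in> ST \<and> i \<noteq> j}"
  have fin: "finite SR" "finite ST" "finite R" "finite T" using assms(1-5) finite_subset by blast+
  have "finite ?E1" by (rule finite_subset[of _ "SR \<times> ST"]) (use fin in auto)
  moreover have "finite ?E" using fin by blast
  ultimately have "card ?E1 + card ?E = card (?E1 \<union> ?E)"
    by (intro card_Un_disjoint[symmetric]) auto
  also have "\<dots> \<le> card {(i, j). i \<in> R \<union> SR \<and> j \<in> T \<union> ST \<and> i \<noteq> j}"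
  proof (rule card_mono)
    show "finite {(i, j). i \<in> R \<union> SR \<and> j \<in> T \<union> ST \<and> i \<noteq> j}"
      by (rule finite_subset[of _ "(R \<union> SR) \<times> (T \<union> ST)"]) (use fin in auto)
  qed auto
  finally have "N_Eq SR ST + int (card ?E) \<le> N_Eq (R \<union> SR) (T \<union> ST)" by (simp add: N_Eq_def)
  also have "\<dots> \<le> N_Var N M (R \<union> SR) (T \<union> ST)" using feasible assms(2-5) by simp
  also have "\<dots> = N_Var N M SR ST +
      N_Var (\<lambda>i. if i \<in> SR then 1 else N i) (\<lambda>j. if j \<in> ST then 1 else M j) R T"
  proof -
    have *: "(\<Sum>i\<in>A \<union> S. int (K i) - 1) =
        (\<Sum>i\<in>S. int (K i) - 1) + (\<Sum>i\<in>A. int (if i \<in> S then 1 else K i) - 1)"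
      if "finite A" "finite S" for A S and K :: "nat \<Rightarrow> nat"
    proof -
      have "(\<Sum>i\<in>A \<union> S. int (K i) - 1) = (\<Sum>i\<in>S \<union> (A - S). int (K i) - 1)"
        by (intro sum.cong) auto
      also have "\<dots> = (\<Sum>i\<in>S. int (K i) - 1) + (\<Sum>i\<in>A - S. int (K i) - 1)"
        using that by (intro sum.union_disjoint) auto
      also have "(\<Sum>i\<in>A - S. int (K i) - 1) = (\<Sum>i\<in>A. int (if i \<in> S then 1 else K i) - 1)"
        using that by (intro sum.mono_neutral_cong_left) auto
      finally show ?thesis .
    qed
    show ?thesis unfolding N_Var_def using *[of R SR N] *[of T ST M] fin by simp
  qed
  finally show ?thesis using tight by simp
qed

theorem theorem3:
  fixes K :: nat and N M :: "nat \<Rightarrow> nat" and SR ST :: "nat set" and \<mu> :: "complex measure"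
  assumes "K \<ge> 2"
    and "\<forall>k\<in>users K. N k \<ge> 1 \<and> M k \<ge> 1"
    and "tightly_feasible K N M"
    and "SR \<subseteq> users K" and "ST \<subseteq> users K"
    and "N_Var N M SR ST = N_Eq SR ST"
    and "continuous_distr \<mu>"
  shows "IA_feasible_under K N M \<mu> (\<lambda>j. if j \<in> ST then A_blocks SR ST else all_ones)"
proof -
  let ?U = "users K"
  have fin: "finite ?U" "finite SR" "finite ST"
    using assms(4,5) finite_subset by (auto simp: users_def)
  have feasible: "N_Eq R T \<le> N_Var N M R T" if "R \<subseteq> ?U" "T \<subseteq> ?U" for R T
    using assms(3) that by (auto simp: tightly_feasible_def IA_feasible_full_def)
  have pos: "N k \<ge> 1" "M k \<ge> 1" if "k \<in> ?U" for k using assms(2) that by auto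

  let ?E1 = "{(i, j). i \<in> SR \<and> j \<in> ST \<and> i \<noteq> j}"
  have stage1: "\<forall>G :: idx \<Rightarrow> complex. \<exists>g t. (\<forall>i\<in>SR. \<exists>r<N i. g i r \<noteq> 0) \<and> (\<forall>j\<in>ST. \<exists>c<M j. t j c \<noteq> 0) \<and>
    (\<forall>i j. (i, j) \<in> ?E1 \<longrightarrow> (\<Sum>r<N i. \<Sum>c<M j. cnj (g i r) * G (i, j, r, c) * t j c) = 0)"
    (is "\<forall>G. ?P G")
  proof
    fix G :: "idx \<Rightarrow> complex"
    show "?P G"
    proof (rule bipartite_system_solvable[OF fin(2,3)])
      fix R T assume RT: "R \<subseteq> SR" "T \<subseteq> ST"
      then have "?E1 \<inter> R \<times> T = {(i, j). i \<in> R \<and> j \<in> T \<and> i \<noteq> j}" by auto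
      then have "int (card (?E1 \<inter> R \<times> T)) = N_Eq R T" by (simp add: N_Eq_def)
      then show "int (card (?E1 \<inter> R \<times> T)) \<le> N_Var N M R T"
        using feasible[of R T] RT assms(4,5) by auto
    qed (use assms(4,5) pos in auto)
  qed
  \<comment> \<open>Solutions are chosen as functions of \<open>G\<close> alone; applied to the
    masked channel they respect the limited CSIT.\<close>
  from choice2[OF stage1] obtain g1 t1 where
    g1: "\<And>G i. i \<in> SR \<Longrightarrow> \<exists>r<N i. g1 G i r \<noteq> 0" and
    t1: "\<And>G j. j \<in> ST \<Longrightarrow> \<exists>c<M j. t1 G j c \<noteq> 0" and
    eq1: "\<And>(G :: idx \<Rightarrow> complex) i j. (i, j) \<in> ?E1 \<Longrightarrow>
      (\<Sum>r<N i. \<Sum>c<M j. cnj (g1 G i r) * G (i, j, r, c) * t1 G j c) = 0"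
    by blast

  define N2 where "N2 i = (if i \<in> SR then 1 else N i)" for i
  define M2 where "M2 j = (if j \<in> ST then 1 else M j)" for j
  define mask where "mask = hadamard K N M (A_blocks SR ST)"
  \<comment> \<open>The effective channel of the second stage: fixed receive vectors collapse the
    rows, fixed beamformers the columns. The unknown at such a user is a single scalar.\<close>
  define G2 where "G2 H i j r c =
    (if i \<in> SR then \<Sum>r<N i. cnj (g1 (mask H) i r) * H (i, j, r, c)
     else if j \<in> ST then \<Sum>c<M j. H (i, j, r, c) * t1 (mask H) j c
     else H (i, j, r, c))" for H :: "idx \<Rightarrow> complex" and i j r c :: nat
  let ?E2 = "{(i, j). i \<in> ?U \<and> j \<in> ?U \<and> i \<noteq> j \<and> \<not> (i \<in> SR \<and> j \<in> ST)}"
  have stage2: "\<forall>H. \<exists>g t. (\<forall>i\<in>?U. \<exists>r<N2 i. g i r \<noteq> 0) \<and> (\<forall>j\<in>?U. \<exists>c<M2 j. t j c \<noteq> 0) \<and>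
    (\<forall>i j. (i, j) \<in> ?E2 \<longrightarrow> (\<Sum>r<N2 i. \<Sum>c<M2 j. cnj (g i r) * G2 H i j r c * t j c) = 0)"
    (is "\<forall>H. ?P H")
  proof
    fix H
    show "?P H"
    proof (rule bipartite_system_solvable[OF fin(1,1)])
      fix R T assume "R \<subseteq> ?U" "T \<subseteq> ?U"
      then show "int (card (?E2 \<inter> R \<times> T)) \<le> N_Var N2 M2 R T"
        using residual_count[OF fin(1) assms(4,5) _ _ feasible assms(6), of R T]
        by (simp add: N2_def[abs_def] M2_def[abs_def])
    qed (use pos in \<open>auto simp: N2_def M2_def\<close>)
  qed
  from choice2[OF stage2] obtain g2 t2 where
    g2: "\<And>H i. i \<in> ?U \<Longrightarrow> \<exists>r<N2 i. g2 H i r \<noteq> 0" and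
    t2: "\<And>H j. j \<in> ?U \<Longrightarrow> \<exists>c<M2 j. t2 H j c \<noteq> 0" and
    eq2: "\<And>H i j. (i, j) \<in> ?E2 \<Longrightarrow>
      (\<Sum>r<N2 i. \<Sum>c<M2 j. cnj (g2 H i r) * G2 H i j r c * t2 H j c) = 0"
    by blast

  \<comment> \<open>A transmitter in \<open>ST\<close> is handed the masked channel and uses the
    first stage directly. Every other transmitter sees the whole channel and can recompute the first
    stage inside \<open>G2\<close>.\<close>
  define f where "f j G = (if j \<in> ST then t1 G j else t2 G j)" for j G
  have f_nz: "\<exists>c<M j. f j G c \<noteq> 0" if "j \<in> ?U" for j G
    using t1[of j G] t2[OF that, of G] by (auto simp: f_def M2_def)
  have "\<exists>g. (\<forall>i\<in>?U. \<exists>r<N i. g i r \<noteq> 0) \<and>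
      (\<forall>i\<in>?U. \<forall>j\<in>?U. i \<noteq> j \<longrightarrow> (\<Sum>r<N i. \<Sum>c<M j. cnj (g i r) * H (i, j, r, c) *
         f j (hadamard K N M (if j \<in> ST then A_blocks SR ST else all_ones) H) c) = 0)" for H
  proof -
    \<comment> \<open>The input of a fully informed transmitter. Its mask agrees with that of
      \<open>H\<close>, so both kinds of transmitters rely on the same first-stage solution.\<close>
    define H' where "H' = hadamard K N M all_ones H"
    have mask_H': "mask H' = mask H" by (auto simp: mask_def H'_def hadamard_def all_ones_def)
    have H': "H' (i, j, r, c) = H (i, j, r, c)"
      if "i \<in> ?U" "j \<in> ?U" "r < N i" "c < M j" for i j r c
      using that by (simp add: H'_def hadamard_def all_ones_def chan_idx_def)
    have mask_H: "mask H (i, j, r, c) = H (i, j, r, c)"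
      if "i \<in> SR" "j \<in> ST" "i \<noteq> j" "r < N i" "c < M j" for i j r c
      using that assms(4,5) by (auto simp: mask_def hadamard_def A_blocks_def chan_idx_def)
    define t where "t j = (if j \<in> ST then t1 (mask H) j else t2 H' j)" for j
    have t: "f j (hadamard K N M (if j \<in> ST then A_blocks SR ST else all_ones) H) = t j" for j
      by (simp add: f_def t_def mask_def H'_def)
    define g where "g i = (if i \<in> SR then g1 (mask H) i else g2 H' i)" for i
    have "\<exists>r<N i. g i r \<noteq> 0" if "i \<in> ?U" for i
      using g1[of i "mask H"] g2[OF that, of H'] by (auto simp: g_def N2_def)
    moreover have "(\<Sum>r<N i. \<Sum>c<M j. cnj (g i r) * H (i, j, r, c) * t j c) = 0"
      if ij: "i \<in> ?U" "j \<in> ?U" "i \<noteq> j" for i j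
    proof -
      have subst: "(\<Sum>r<N i. \<Sum>c<M j. cnj (g i r) * H (i, j, r, c) * t j c) =
          (\<Sum>r<N i. \<Sum>c<M j. cnj (g i r) * H' (i, j, r, c) * t j c)"
        using H' ij by simp
      consider "i \<in> SR" "j \<in> ST" | "i \<in> SR" "j \<notin> ST" | "i \<notin> SR" "j \<in> ST" | "i \<notin> SR" "j \<notin> ST" by blast
      then show ?thesis
      proof cases
        case 1
        have "(\<Sum>r<N i. \<Sum>c<M j. cnj (g i r) * H (i, j, r, c) * t j c) =
            (\<Sum>r<N i. \<Sum>c<M j. cnj (g1 (mask H) i r) * mask H (i, j, r, c) * t1 (mask H) j c)"
          using 1 mask_H ij by (intro sum.cong) (auto simp: g_def t_def)
        then show ?thesis using eq1 1 ij by simp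
      next
        case 2
        \<comment> \<open>The scalar left at a collapsed user is nonzero and cancels from the
          second-stage equation, leaving the original alignment condition.\<close>
        have nz: "g2 H' i 0 \<noteq> 0" using g2[OF ij(1), of H'] 2 by (simp add: N2_def)
        have "0 = (\<Sum>r<N2 i. \<Sum>c<M2 j. cnj (g2 H' i r) * G2 H' i j r c * t2 H' j c)"
          using eq2[of i j H'] 2 ij by simp
        also have "\<dots> = cnj (g2 H' i 0) * (\<Sum>c<M j. \<Sum>r<N i. cnj (g i r) * H' (i, j, r, c) * t j c)"
          using 2 by (simp add: N2_def M2_def G2_def g_def t_def mask_H' sum_distrib_left sum_distrib_right mult.assoc)
        finally show ?thesis using nz unfolding subst by (subst sum.swap) simp
      next
        case 3
        have nz: "t2 H' j 0 \<noteq> 0" using t2[OF ij(2), of H'] 3 by (simp add: M2_def)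
        have "0 = (\<Sum>r<N2 i. \<Sum>c<M2 j. cnj (g2 H' i r) * G2 H' i j r c * t2 H' j c)"
          using eq2[of i j H'] 3 ij by simp
        also have "\<dots> = (\<Sum>r<N i. \<Sum>c<M j. cnj (g i r) * H' (i, j, r, c) * t j c) * t2 H' j 0"
          using 3 by (simp add: N2_def M2_def G2_def g_def t_def mask_H' sum_distrib_left sum_distrib_right mult.assoc)
        finally show ?thesis using nz unfolding subst by simp
      next
        case 4
        then show ?thesis
          unfolding subst using eq2[of i j H'] ij by (simp add: N2_def M2_def G2_def g_def t_def)
      qed
    qed
    ultimately show ?thesis unfolding t by (intro exI[of _ g]) blast
  qed
  with f_nz show ?thesis
    unfolding IA_feasible_under_def by (intro exI[of _ f] conjI ballI allI AE_I2) auto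
qed

end
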